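(* In the setting described in the context (no multiplicity-one hypothesis is imposed), let $\mathfrak h=(F,A,b,\lambda)$ be a frame-profile certificate on $(E,\Omega,\mathcal E)$ and let $s\in\mathbb R$ with $\lambda>\max\{s,0\}$. Then every $\mathcal C\subseteq X$ satisfying $t(x,y)\le s$ for all distinct $x,y\in\mathcal C$ obeys $$|\mathcal C|\le\mathsf B(\mathfrak h;s):=\frac{(1-s)\,m}{d_E\,(\lambda-s)\,\Delta(A)},\qquad m=\dim F.$$
   Context: Setting. A finite group $G$ acts transitively on a finite set $X$; $o\in X$, $H=\mathrm{Stab}_G(o)$. $W$ is a finite-dimensional unitary $G$-representation and $x\mapsto\ell_x\in W$ is $G$-equivariant with $\|\ell_x\|=1$ and $t(x,y)=\langle\ell_x,\ell_y\rangle\in\mathbb R$. $E$ is an irreducible unitary $H$-representation, $d_E=\dim E$. $\Omega$ is a nonempty finite family of pairwise inequivalent irreducible unitary $G$-representations $V_\omega$, $D_\omega=\dim V_\omega$. Put $M_\omega=\mathrm{Hom}_H(E,\mathrm{Res}^G_HV_\omega)$ with the Hilbert-space structure for which the evaluation map $M_\omega\otimes E\to V_\omega$, $a\otimes u\mapsto a(u)$, is isometric. $\mathcal E$ is a finite directed edge set (parallel edges allowed): each $e\in\mathcal E$ has a source $s(e)=\omega\in\Omega$, a target $t(e)=\nu\in\Omega$, and an isometric $G$-intertwiner $C_e:V_\nu\to W\otimes V_\omega$; for each fixed pair $(\omega,\nu)$ the images of the intertwiners of the parallel edges are pairwise orthogonal. For $e$ from $\omega$ to $\nu$, $T_e:M_\omega\to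 M_\nu$ is the linear map defined by $(T_ea)(u)=C_e^*(\ell_o\otimes a(u))$ for $a\in M_\omega$, $u\in E$. A frame-profile certificate on $(E,\Omega,\mathcal E)$ consists of: (a) a nonzero finite-dimensional Hilbert space $F$, $m=\dim F$; (b) linear maps $A_\omega:F\to M_\omega$ with $\sum_{\omega\in\Omega}A_\omega^*A_\omega=\mathrm{Id}_F$; (c) scalars $b_e\in\mathbb C$ ($e\in\mathcal E$) with $\sum_{e:\,t(e)=\nu}|b_e|^2\le1$ for every $\nu\in\Omega$; (d) a number $\lambda>0$ with $\sum_{e:\,t(e)=\nu}\overline{b_e}\,T_eA_{s(e)}=\sqrt\lambda\,A_\nu$ for every $\nu\in\Omega$. Set $q_\omega=\|A_\omega\|_{\mathrm F}^2$ (Frobenius/Hilbert--Schmidt norm) and $\Delta(A)=\sum_{\omega\in\Omega}q_\omega^2/D_\omega$. *)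

theory Defs
  imports
    "Jordan_Normal_Form.Spectral_Radius"
    "HOL-Algebra.Group_Action"
begin

text \<open>
  A Hilbert space of finite dimension \<open>n\<close> is presented by an orthonormal basis, i.e. as
  \<^term>\<open>carrier_vec n :: complex vec set\<close> with \<open>v \<bullet>c w\<close> (linear in \<open>v\<close>) as inner product;
  a linear map from dimension \<open>n\<close> to dimension \<open>k\<close> is an element of
  \<^term>\<open>carrier_mat k n :: complex mat set\<close>, with adjoint \<^const>\<open>mat_adjoint\<close>.
\<close>

section \<open>Tensor products\<close>

text \<open>The product basis of the tensor product is enumerated lexicographically.\<close>

definition tensor_vec :: "complex vec \<Rightarrow> complex vec \<Rightarrow> complex vec" (infixl \<open>\<otimes>\<^sub>v\<close> 70) where
  "u \<otimes>\<^sub>v v = vec (dim_vec u * dim_vec v) (\<lambda>i. u $ (i div dim_vec v) * v $ (i mod dim_vec v))"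

definition tensor_mat :: "complex mat \<Rightarrow> complex mat \<Rightarrow> complex mat" (infixl \<open>\<otimes>\<^sub>m\<close> 70) where
  "A \<otimes>\<^sub>m B = mat (dim_row A * dim_row B) (dim_col A * dim_col B)
     (\<lambda>(i, j). A $$ (i div dim_row B, j div dim_col B) * B $$ (i mod dim_row B, j mod dim_col B))"

lemma sum_div_mod:
  fixes f :: "nat \<Rightarrow> nat \<Rightarrow> 'a :: comm_monoid_add"
  shows "(\<Sum>i<a * b. f (i div b) (i mod b)) = (\<Sum>i<a. \<Sum>j<b. f i j)"
proof (cases "b = 0")
  case False
  have "(\<Sum>i<a. \<Sum>j<b. f i j) = (\<Sum>i<a. \<Sum>j\<in>{i * b..<i * b + b}. f (j div b) (j mod b))"
  proof (rule sum.cong[OF refl])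
    fix i
    have "(\<Sum>j\<in>{0 + i * b..<b + i * b}. f (j div b) (j mod b))
        = (\<Sum>j = 0..<b. f ((j + i * b) div b) ((j + i * b) mod b))"
      by (rule sum.shift_bounds_nat_ivl)
    also have "\<dots> = (\<Sum>j<b. f i j)"
      using False by (simp add: atLeast0LessThan)
    finally show "(\<Sum>j<b. f i j) = (\<Sum>j\<in>{i * b..<i * b + b}. f (j div b) (j mod b))"
      by (simp add: add.commute)
  qed
  then show ?thesis
    by (simp add: sum.nat_group)
qed simp

lemma tensor_vec_inner:
  assumes "dim_vec u = dim_vec u'" "dim_vec v = dim_vec v'"
  shows "(u \<otimes>\<^sub>v v) \<bullet>c (u' \<otimes>\<^sub>v v') = (u \<bullet>c u') * (v \<bullet>c v')"
proof -
  let ?a = "dim_vec u'" and ?b = "dim_vec v'"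
  have lt: "i div ?b < ?a \<and> i mod ?b < ?b" if "i < ?a * ?b" for i
    using that by (metis less_mult_imp_div_less mod_less_divisor mult_0_right not_gr_zero not_less0)
  have "(u \<otimes>\<^sub>v v) \<bullet>c (u' \<otimes>\<^sub>v v')
      = (\<Sum>i<?a * ?b. (u $ (i div ?b) * cnj (u' $ (i div ?b))) * (v $ (i mod ?b) * cnj (v' $ (i mod ?b))))"
    using assms lt by (auto simp: scalar_prod_def tensor_vec_def atLeast0LessThan intro!: sum.cong)
  also have "\<dots> = (\<Sum>i<?a. \<Sum>j<?b. (u $ i * cnj (u' $ i)) * (v $ j * cnj (v' $ j)))"
    by (rule sum_div_mod)
  also have "\<dots> = (u \<bullet>c u') * (v \<bullet>c v')"
    by (simp add: scalar_prod_def atLeast0LessThan sum_product)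
  finally show ?thesis .
qed

lemma tensor_mat_mult_vec:
  assumes "dim_vec u = dim_col A" "dim_vec v = dim_col B"
  shows "(A \<otimes>\<^sub>m B) *\<^sub>v (u \<otimes>\<^sub>v v) = (A *\<^sub>v u) \<otimes>\<^sub>v (B *\<^sub>v v)"
proof (rule eq_vecI)
  let ?a = "dim_col A" and ?b = "dim_col B"
  fix i assume "i < dim_vec ((A *\<^sub>v u) \<otimes>\<^sub>v (B *\<^sub>v v))"
  then have i: "i < dim_row A * dim_row B" by (simp add: tensor_vec_def)
  then have i': "i div dim_row B < dim_row A" "i mod dim_row B < dim_row B"
    by (metis less_mult_imp_div_less mod_less_divisor mult_0_right not_gr_zero not_less0)+
  have lt: "j div ?b < ?a \<and> j mod ?b < ?b" if "j < ?a * ?b" for j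
    using that by (metis less_mult_imp_div_less mod_less_divisor mult_0_right not_gr_zero not_less0)
  have "((A \<otimes>\<^sub>m B) *\<^sub>v (u \<otimes>\<^sub>v v)) $ i
      = (\<Sum>j<?a * ?b. (A $$ (i div dim_row B, j div ?b) * u $ (j div ?b))
                    * (B $$ (i mod dim_row B, j mod ?b) * v $ (j mod ?b)))"
    using assms lt i
    by (auto simp: scalar_prod_def tensor_vec_def tensor_mat_def atLeast0LessThan intro!: sum.cong)
  also have "\<dots> = (\<Sum>j<?a. \<Sum>k<?b. (A $$ (i div dim_row B, j) * u $ j) * (B $$ (i mod dim_row B, k) * v $ k))"
    by (rule sum_div_mod)
  also have "\<dots> = ((A *\<^sub>v u) \<otimes>\<^sub>v (B *\<^sub>v v)) $ i"
    using assms i i' by (simp add: scalar_prod_def tensor_vec_def atLeast0LessThan sum_product)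
  finally show "((A \<otimes>\<^sub>m B) *\<^sub>v (u \<otimes>\<^sub>v v)) $ i = ((A *\<^sub>v u) \<otimes>\<^sub>v (B *\<^sub>v v)) $ i" .
qed (simp add: tensor_vec_def tensor_mat_def)

section \<open>Unitary representations\<close>

definition unitary_group :: "nat \<Rightarrow> complex mat monoid" where
  "unitary_group n =
    \<lparr>carrier = {U \<in> carrier_mat n n. mat_adjoint U * U = 1\<^sub>m n \<and> U * mat_adjoint U = 1\<^sub>m n},
     mult = (*), one = 1\<^sub>m n\<rparr>"

definition unitary_rep :: "('g, 'r) monoid_scheme \<Rightarrow> nat \<Rightarrow> ('g \<Rightarrow> complex mat) \<Rightarrow> bool" where
  "unitary_rep G n \<rho> \<longleftrightarrow> \<rho> \<in> hom G (unitary_group n)"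

definition irreducible_rep :: "('g, 'r) monoid_scheme \<Rightarrow> nat \<Rightarrow> ('g \<Rightarrow> complex mat) \<Rightarrow> bool" where
  "irreducible_rep G n \<rho> \<longleftrightarrow> n \<noteq> 0 \<and>
    (\<forall>S. subspace class_ring S (module_vec TYPE(complex) n) \<longrightarrow>
         (\<forall>g\<in>carrier G. \<forall>v\<in>S. \<rho> g *\<^sub>v v \<in> S) \<longrightarrow> S = {0\<^sub>v n} \<or> S = carrier_vec n)"

definition intertwiners ::
  "('g, 'r) monoid_scheme \<Rightarrow> nat \<Rightarrow> ('g \<Rightarrow> complex mat) \<Rightarrow> nat \<Rightarrow> ('g \<Rightarrow> complex mat) \<Rightarrow> complex mat set" where
  "intertwiners G n \<rho> k \<sigma> = {a \<in> carrier_mat k n. \<forall>g\<in>carrier G. a * \<rho> g = \<sigma> g * a}"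

definition equivalent_reps ::
  "('g, 'r) monoid_scheme \<Rightarrow> nat \<Rightarrow> ('g \<Rightarrow> complex mat) \<Rightarrow> nat \<Rightarrow> ('g \<Rightarrow> complex mat) \<Rightarrow> bool" where
  "equivalent_reps G n \<rho> k \<sigma> \<longleftrightarrow>
    (\<exists>P\<in>intertwiners G n \<rho> k \<sigma>. \<exists>Q\<in>carrier_mat n k. Q * P = 1\<^sub>m n \<and> P * Q = 1\<^sub>m k)"

section \<open>The multiplicity spaces\<close>

text \<open>
  For a representation \<open>\<tau>\<close> of \<open>K\<close> on dimension \<open>d\<close> and \<open>\<rho>\<close> on dimension \<open>n\<close>: the
  vector space \<open>Hom\<^sub>K(\<tau>, \<rho>)\<close>.
\<close>

definition hom_space ::
  "('g, 'r) monoid_scheme \<Rightarrow> nat \<Rightarrow> ('g \<Rightarrow> complex mat) \<Rightarrow> nat \<Rightarrow> ('g \<Rightarrow> complex mat)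
    \<Rightarrow> (complex, complex mat) module" where
  "hom_space K d \<tau> n \<rho> = module_mat TYPE(complex) n d \<lparr>carrier := intertwiners K d \<tau> n \<rho>\<rparr>"

text \<open>
  The inner product on \<open>Hom\<^sub>K(\<tau>, \<rho>)\<close> that makes the evaluation map \<open>a \<otimes> u \<mapsto> a u\<close> isometric;
  isometry is expressed on pure tensors, which span. It exists and is unique by Schur's lemma
  when \<open>\<tau>\<close> is irreducible (\<open>hom_inner_unique\<close> below).
\<close>

definition hom_inner :: "nat \<Rightarrow> complex mat \<Rightarrow> complex mat \<Rightarrow> complex" where
  "hom_inner d a b = (THE c. \<forall>u\<in>carrier_vec d. \<forall>v\<in>carrier_vec d.
     (a *\<^sub>v u) \<bullet>c (b *\<^sub>v v) = c * (u \<bullet>c v))"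

lemma mat_adjoint_carrier: "A \<in> carrier_mat k n \<Longrightarrow> mat_adjoint A \<in> carrier_mat n k"
  unfolding mat_adjoint_def by (intro carrier_matI) simp_all

lemma mat_adjoint_index:
  "i < dim_col A \<Longrightarrow> j < dim_row A \<Longrightarrow> mat_adjoint A $$ (i, j) = cnj (A $$ (j, i))"
  by (simp add: mat_adjoint_def mat_of_rows_index)

lemma mat_adjoint_inner:
  fixes A :: "complex mat"
  assumes A: "A \<in> carrier_mat k n" and u: "u \<in> carrier_vec n" and v: "v \<in> carrier_vec k"
  shows "(A *\<^sub>v u) \<bullet>c v = u \<bullet>c (mat_adjoint A *\<^sub>v v)"
proof -
  have "(A *\<^sub>v u) \<bullet>c v = (\<Sum>i<k. \<Sum>j<n. A $$ (i, j) * u $ j * cnj (v $ i))"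
    using assms by (auto simp: scalar_prod_def atLeast0LessThan sum_distrib_right intro!: sum.cong)
  also have "\<dots> = (\<Sum>j<n. \<Sum>i<k. A $$ (i, j) * u $ j * cnj (v $ i))"
    by (rule sum.swap)
  also have "\<dots> = u \<bullet>c (mat_adjoint A *\<^sub>v v)"
    using assms mat_adjoint_carrier[OF A]
    by (auto simp: scalar_prod_def atLeast0LessThan sum_distrib_left mat_adjoint_index
        intro!: sum.cong)
  finally show ?thesis .
qed

lemma vec_eqI_inner:
  fixes x y :: "complex vec"
  assumes "x \<in> carrier_vec n" "y \<in> carrier_vec n"
    and "\<And>v. v \<in> carrier_vec n \<Longrightarrow> x \<bullet>c v = y \<bullet>c v"
  shows "x = y"
proof -
  have "(x - y) \<bullet>c (x - y) = x \<bullet>c (x - y) - y \<bullet>c (x - y)"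
    using assms(1,2) by (intro minus_scalar_prod_distrib[where n = n]) auto
  then have "(x - y) \<bullet>c (x - y) = 0"
    using assms by simp
  then have eq: "x - y = 0\<^sub>v n"
    using assms(1,2) by (subst conjugate_square_eq_0_vec[symmetric, of _ n]) auto
  show ?thesis
  proof (rule eq_vecI)
    fix i assume "i < dim_vec y"
    then show "x $ i = y $ i"
      using arg_cong[OF eq, of "\<lambda>w. w $ i"] assms(1,2) by auto
  qed (use assms in auto)
qed

lemma unitary_repD:
  assumes "unitary_rep G n \<rho>" "g \<in> carrier G"
  shows "\<rho> g \<in> carrier_mat n n" "mat_adjoint (\<rho> g) * \<rho> g = 1\<^sub>m n" "\<rho> g * mat_adjoint (\<rho> g) = 1\<^sub>m n"
  using hom_in_carrier[OF assms(1)[unfolded unitary_rep_def] assms(2)]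
  by (auto simp: unitary_group_def)

lemma unitary_rep_inner:
  assumes "unitary_rep G n \<rho>" "g \<in> carrier G" "u \<in> carrier_vec n" "v \<in> carrier_vec n"
  shows "(\<rho> g *\<^sub>v u) \<bullet>c (\<rho> g *\<^sub>v v) = u \<bullet>c v"
proof -
  note c = unitary_repD[OF assms(1,2)]
  have "mat_adjoint (\<rho> g) *\<^sub>v (\<rho> g *\<^sub>v v) = v"
    using assoc_mult_mat_vec[OF mat_adjoint_carrier[OF c(1)] c(1) assms(4)] c(2) assms(4) by simp
  then show ?thesis
    using mat_adjoint_inner[OF c(1) assms(3), of "\<rho> g *\<^sub>v v"] c(1) assms(4) by simp
qed

lemma schur:
  assumes irr: "irreducible_rep G d \<tau>" and un: "unitary_rep G d \<tau>"
    and N: "N \<in> carrier_mat d d"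
    and comm: "\<And>g u. g \<in> carrier G \<Longrightarrow> u \<in> carrier_vec d \<Longrightarrow> N *\<^sub>v (\<tau> g *\<^sub>v u) = \<tau> g *\<^sub>v (N *\<^sub>v u)"
  obtains c where "\<And>u. u \<in> carrier_vec d \<Longrightarrow> N *\<^sub>v u = c \<cdot>\<^sub>v u"
proof -
  have "d \<noteq> 0" using irr by (simp add: irreducible_rep_def)
  then obtain c where "eigenvalue N c"
    using spectrum_non_empty[OF N] by (auto simp: spectrum_def)
  then obtain w where w: "w \<in> carrier_vec d" "w \<noteq> 0\<^sub>v d" "N *\<^sub>v w = c \<cdot>\<^sub>v w"
    using N by (auto simp: eigenvalue_def eigenvector_def)
  define S where "S = {w \<in> carrier_vec d. N *\<^sub>v w = c \<cdot>\<^sub>v w}"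
  interpret vs: vec_space "TYPE(complex)" d .
  have "subspace class_ring S (module_vec TYPE(complex) d)"
  proof (rule subspace.intro)
    show "vectorspace class_ring (module_vec TYPE(complex) d)"
      by (rule vs.vectorspace_axioms)
    show "LinearCombinations.submodule class_ring S (module_vec TYPE(complex) d)"
      using N vs.module_axioms
      by (auto simp: LinearCombinations.submodule_def S_def module_vec_simps class_ring_simps
          mult_add_distrib_mat_vec smult_add_distrib_vec mult_mat_vec smult_smult_assoc mult.commute)
  qed
  moreover have "\<forall>g\<in>carrier G. \<forall>v\<in>S. \<tau> g *\<^sub>v v \<in> S"
  proof (intro ballI)
    fix g v assume g: "g \<in> carrier G" and v: "v \<in> S"
    from v have vc: "v \<in> carrier_vec d" and ve: "N *\<^sub>v v = c \<cdot>\<^sub>v v" by (auto simp: S_def)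
    show "\<tau> g *\<^sub>v v \<in> S"
      using comm[OF g vc] ve unitary_repD(1)[OF un g] vc
      by (auto simp: S_def mult_mat_vec)
  qed
  ultimately have "S = {0\<^sub>v d} \<or> S = carrier_vec d"
    using irr by (auto simp: irreducible_rep_def)
  moreover have "w \<in> S" using w by (simp add: S_def)
  ultimately have "S = carrier_vec d" using w by auto
  then show ?thesis using that[of c] by (auto simp: S_def)
qed

lemma hom_inner_unique:
  assumes irr: "irreducible_rep K d \<tau>" and un\<tau>: "unitary_rep K d \<tau>" and un\<rho>: "unitary_rep K n \<rho>"
    and a: "a \<in> intertwiners K d \<tau> n \<rho>" and b: "b \<in> intertwiners K d \<tau> n \<rho>"
  shows "\<exists>!c. \<forall>u\<in>carrier_vec d. \<forall>v\<in>carrier_vec d. (a *\<^sub>v u) \<bullet>c (b *\<^sub>v v) = c * (u \<bullet>c v)"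
proof -
  have ac: "a \<in> carrier_mat n d" and bc: "b \<in> carrier_mat n d"
    using a b by (auto simp: intertwiners_def)
  define N where "N = mat_adjoint b * a"
  have Nc: "N \<in> carrier_mat d d"
    unfolding N_def using ac mat_adjoint_carrier[OF bc] by auto
  have Nin: "(N *\<^sub>v u) \<bullet>c v = (a *\<^sub>v u) \<bullet>c (b *\<^sub>v v)"
    if u: "u \<in> carrier_vec d" and v: "v \<in> carrier_vec d" for u v
  proof -
    have au: "a *\<^sub>v u \<in> carrier_vec n" using ac u by auto
    have bv: "b *\<^sub>v v \<in> carrier_vec n" using bc v by auto
    have sym: "x \<bullet>c y = cnj (y \<bullet>c x)" if "x \<in> carrier_vec m" "y \<in> carrier_vec m" for x y m
      using that by (auto simp: scalar_prod_def mult.commute)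
    have "(N *\<^sub>v u) \<bullet>c v = cnj (v \<bullet>c (mat_adjoint b *\<^sub>v (a *\<^sub>v u)))"
      using sym[of "N *\<^sub>v u" d v] Nc u v ac mat_adjoint_carrier[OF bc]
      by (simp add: N_def assoc_mult_mat_vec[of _ d n _ d])
    also have "\<dots> = cnj ((b *\<^sub>v v) \<bullet>c (a *\<^sub>v u))"
      using mat_adjoint_inner[OF bc v au] by simp
    also have "\<dots> = (a *\<^sub>v u) \<bullet>c (b *\<^sub>v v)"
      using sym[OF au bv] by simp
    finally show ?thesis .
  qed
  have comm: "N *\<^sub>v (\<tau> g *\<^sub>v u) = \<tau> g *\<^sub>v (N *\<^sub>v u)" if g: "g \<in> carrier K" and u: "u \<in> carrier_vec d" for g u
  proof (rule vec_eqI_inner[of _ d])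
    note t = unitary_repD[OF un\<tau> g] and r = unitary_repD[OF un\<rho> g]
    show "N *\<^sub>v (\<tau> g *\<^sub>v u) \<in> carrier_vec d" "\<tau> g *\<^sub>v (N *\<^sub>v u) \<in> carrier_vec d"
      using Nc t u by auto
    fix v :: "complex vec" assume v: "v \<in> carrier_vec d"
    define v' where "v' = mat_adjoint (\<tau> g) *\<^sub>v v"
    have v': "v' \<in> carrier_vec d" using v mat_adjoint_carrier[OF t(1)] by (auto simp: v'_def)
    have vv: "\<tau> g *\<^sub>v v' = v"
      using assoc_mult_mat_vec[OF t(1) mat_adjoint_carrier[OF t(1)] v] t(3) v by (simp add: v'_def)
    have tr: "x *\<^sub>v (\<tau> g *\<^sub>v y) = \<rho> g *\<^sub>v (x *\<^sub>v y)"
      if "x \<in> intertwiners K d \<tau> n \<rho>" "y \<in> carrier_vec d" for x y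
    proof -
      have xc: "x \<in> carrier_mat n d" and xg: "x * \<tau> g = \<rho> g * x"
        using that(1) g by (auto simp: intertwiners_def)
      show ?thesis
        using assoc_mult_mat_vec[OF xc t(1) that(2)] assoc_mult_mat_vec[OF r(1) xc that(2)] xg
        by simp
    qed
    have "(N *\<^sub>v (\<tau> g *\<^sub>v u)) \<bullet>c v = (a *\<^sub>v (\<tau> g *\<^sub>v u)) \<bullet>c (b *\<^sub>v (\<tau> g *\<^sub>v v'))"
      using Nin[of "\<tau> g *\<^sub>v u" v] t u v vv by simp
    also have "\<dots> = (a *\<^sub>v u) \<bullet>c (b *\<^sub>v v')"
      using tr[OF a u] tr[OF b v'] unitary_rep_inner[OF un\<rho> g] ac bc u v' by simp
    also have "\<dots> = (N *\<^sub>v u) \<bullet>c v'"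
      using Nin[OF u v'] by simp
    also have "\<dots> = (\<tau> g *\<^sub>v (N *\<^sub>v u)) \<bullet>c v"
      using mat_adjoint_inner[OF t(1) _ v, of "N *\<^sub>v u"] Nc u by (simp add: v'_def)
    finally show "(N *\<^sub>v (\<tau> g *\<^sub>v u)) \<bullet>c v = (\<tau> g *\<^sub>v (N *\<^sub>v u)) \<bullet>c v" .
  qed
  obtain c where c: "\<And>u. u \<in> carrier_vec d \<Longrightarrow> N *\<^sub>v u = c \<cdot>\<^sub>v u"
    using schur[OF irr un\<tau> Nc comm] by blast
  have ex: "\<forall>u\<in>carrier_vec d. \<forall>v\<in>carrier_vec d. (a *\<^sub>v u) \<bullet>c (b *\<^sub>v v) = c * (u \<bullet>c v)"
  proof (intro ballI)
    fix u v :: "complex vec" assume "u \<in> carrier_vec d" "v \<in> carrier_vec d"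
    then show "(a *\<^sub>v u) \<bullet>c (b *\<^sub>v v) = c * (u \<bullet>c v)"
      using Nin[of u v] c[of u] by simp
  qed
  have d: "0 < d" using irr by (simp add: irreducible_rep_def)
  have one: "unit_vec d 0 \<bullet>c (unit_vec d 0 :: complex vec) = 1"
    using d by (simp add: scalar_prod_def unit_vec_def if_distrib cong: if_cong)
  show ?thesis
  proof (rule ex1I[of _ c])
    fix c' assume "\<forall>u\<in>carrier_vec d. \<forall>v\<in>carrier_vec d. (a *\<^sub>v u) \<bullet>c (b *\<^sub>v v) = c' * (u \<bullet>c v)"
    then have "c' * (unit_vec d 0 \<bullet>c (unit_vec d 0 :: complex vec))
             = c * (unit_vec d 0 \<bullet>c (unit_vec d 0 :: complex vec))"
      using ex[rule_format, of "unit_vec d 0" "unit_vec d 0"] by simp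
    then show "c' = c" by (simp add: one)
  qed (rule ex)
qed

text \<open>
  For a linear map \<open>A\<close> from the Hilbert space of dimension \<open>m\<close> to a space of intertwiners with the
  inner product above: its adjoint (well defined by \<open>hom_adjoint_unique\<close> below), and its
  Hilbert-Schmidt norm.
\<close>

definition hom_adjoint :: "nat \<Rightarrow> nat \<Rightarrow> (complex vec \<Rightarrow> complex mat) \<Rightarrow> complex mat \<Rightarrow> complex vec" where
  "hom_adjoint d m A a = (THE v. v \<in> carrier_vec m \<and>
     (\<forall>f\<in>carrier_vec m. hom_inner d (A f) a = f \<bullet>c v))"

definition frobenius_norm :: "nat \<Rightarrow> nat \<Rightarrow> (complex vec \<Rightarrow> complex mat) \<Rightarrow> real" where
  "frobenius_norm d m A = sqrt (\<Sum>i<m. Re (hom_inner d (A (unit_vec m i)) (A (unit_vec m i))))"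

lemma hom_innerI:
  assumes "d \<noteq> 0"
    and "\<And>u v. u \<in> carrier_vec d \<Longrightarrow> v \<in> carrier_vec d \<Longrightarrow> (a *\<^sub>v u) \<bullet>c (b *\<^sub>v v) = c * (u \<bullet>c v)"
  shows "hom_inner d a b = c"
  unfolding hom_inner_def
proof (rule the_equality)
  fix c' assume c': "\<forall>u\<in>carrier_vec d. \<forall>v\<in>carrier_vec d. (a *\<^sub>v u) \<bullet>c (b *\<^sub>v v) = c' * (u \<bullet>c v)"
  have "unit_vec d 0 \<bullet>c (unit_vec d 0 :: complex vec) = 1"
    using assms(1) by (simp add: scalar_prod_def unit_vec_def if_distrib cong: if_cong)
  then show "c' = c"
    using c'[rule_format, of "unit_vec d 0" "unit_vec d 0"] assms(2)[of "unit_vec d 0" "unit_vec d 0"]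
    by simp
qed (use assms(2) in blast)

lemma hom_inner_eq:
  assumes "irreducible_rep K d \<tau>" "unitary_rep K d \<tau>" "unitary_rep K n \<rho>"
    and "a \<in> intertwiners K d \<tau> n \<rho>" "b \<in> intertwiners K d \<tau> n \<rho>"
    and "u \<in> carrier_vec d" "v \<in> carrier_vec d"
  shows "(a *\<^sub>v u) \<bullet>c (b *\<^sub>v v) = hom_inner d a b * (u \<bullet>c v)"
  using theI'[OF hom_inner_unique[OF assms(1-5)], folded hom_inner_def, rule_format, OF assms(6,7)] .

lemma hom_adjoint_unique:
  assumes irr: "irreducible_rep K d \<tau>" and un\<tau>: "unitary_rep K d \<tau>" and un\<rho>: "unitary_rep K n \<rho>"
    and A: "A \<in> module_hom class_ring (module_vec TYPE(complex) m) (hom_space K d \<tau> n \<rho>)"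
    and a: "a \<in> intertwiners K d \<tau> n \<rho>"
  shows "\<exists>!v. v \<in> carrier_vec m \<and> (\<forall>f\<in>carrier_vec m. hom_inner d (A f) a = f \<bullet>c v)"
proof -
  have d: "d \<noteq> 0" using irr by (simp add: irreducible_rep_def)
  have ac: "a \<in> carrier_mat n d" using a by (auto simp: intertwiners_def)
  have AM: "A f \<in> intertwiners K d \<tau> n \<rho>" if "f \<in> carrier_vec m" for f
    using module_hom_closed[OF A] that by (auto simp: hom_space_def module_vec_simps)
  then have Ac: "A f \<in> carrier_mat n d" if "f \<in> carrier_vec m" for f
    using that by (auto simp: intertwiners_def)
  have Aadd: "A (f + g) = A f + A g" if "f \<in> carrier_vec m" "g \<in> carrier_vec m" for f g
    using module_hom_add[OF A, of f g] that by (simp add: hom_space_def module_vec_simps module_mat_def)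
  have Asm: "A (c \<cdot>\<^sub>v f) = c \<cdot>\<^sub>m A f" if "f \<in> carrier_vec m" for f c
    using module_hom_smult[OF A, of c f] that
    by (simp add: hom_space_def module_vec_simps module_mat_def class_ring_simps)
  define L where "L f = hom_inner d (A f) a" for f
  have Ladd: "L (f + g) = L f + L g" if f: "f \<in> carrier_vec m" and g: "g \<in> carrier_vec m" for f g
    unfolding L_def
  proof (rule hom_innerI[OF d])
    fix u v :: "complex vec" assume u: "u \<in> carrier_vec d" and v: "v \<in> carrier_vec d"
    have "(A (f + g) *\<^sub>v u) \<bullet>c (a *\<^sub>v v) = (A f *\<^sub>v u) \<bullet>c (a *\<^sub>v v) + (A g *\<^sub>v u) \<bullet>c (a *\<^sub>v v)"
      using Ac[OF f] Ac[OF g] ac u v f g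
      by (simp add: Aadd add_mult_distrib_mat_vec add_scalar_prod_distrib[of _ n])
    then show "(A (f + g) *\<^sub>v u) \<bullet>c (a *\<^sub>v v) = (hom_inner d (A f) a + hom_inner d (A g) a) * (u \<bullet>c v)"
      using hom_inner_eq[OF irr un\<tau> un\<rho> AM a u v] f g by (simp add: distrib_right)
  qed
  have Lsm: "L (c \<cdot>\<^sub>v f) = c * L f" if f: "f \<in> carrier_vec m" for f c
    unfolding L_def
  proof (rule hom_innerI[OF d])
    fix u v :: "complex vec" assume u: "u \<in> carrier_vec d" and v: "v \<in> carrier_vec d"
    have "c \<cdot>\<^sub>m A f *\<^sub>v u = c \<cdot>\<^sub>v (A f *\<^sub>v u)"
      using Ac[OF f] u by (auto simp: scalar_prod_def sum_distrib_left mult.assoc intro!: sum.cong)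
    then have "(A (c \<cdot>\<^sub>v f) *\<^sub>v u) \<bullet>c (a *\<^sub>v v) = c * ((A f *\<^sub>v u) \<bullet>c (a *\<^sub>v v))"
      using Ac[OF f] ac u v f by (simp add: Asm)
    then show "(A (c \<cdot>\<^sub>v f) *\<^sub>v u) \<bullet>c (a *\<^sub>v v) = c * hom_inner d (A f) a * (u \<bullet>c v)"
      using hom_inner_eq[OF irr un\<tau> un\<rho> AM a u v] f by simp
  qed
  have Lsum: "L f = (\<Sum>i<m. f $ i * L (unit_vec m i))" if f: "f \<in> carrier_vec m" for f
  proof -
    define p where "p k = vec m (\<lambda>i. if i < k then f $ i else 0)" for k
    have pc: "p k \<in> carrier_vec m" for k by (simp add: p_def)
    have "k \<le> m \<Longrightarrow> L (p k) = (\<Sum>i<k. f $ i * L (unit_vec m i))" for k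
    proof (induction k)
      case 0
      have "p 0 = 0 \<cdot>\<^sub>v p 0" by (auto simp: p_def)
      then show ?case using Lsm[OF pc, of 0 0] by simp
    next
      case (Suc k)
      have "p (Suc k) = p k + f $ k \<cdot>\<^sub>v unit_vec m k"
        using Suc.prems by (auto simp: p_def less_Suc_eq)
      then show ?case
        using Suc by (simp add: Ladd pc Lsm)
    qed
    moreover have "p m = f" using f by (auto simp: p_def)
    ultimately show ?thesis by (metis order_refl)
  qed
  define w where "w = vec m (\<lambda>i. cnj (L (unit_vec m i)))"
  have w: "L f = f \<bullet>c w" if "f \<in> carrier_vec m" for f
    using Lsum[OF that] that by (simp add: w_def scalar_prod_def atLeast0LessThan)
  show ?thesis
  proof (rule ex1I[of _ w])
    show "w \<in> carrier_vec m \<and> (\<forall>f\<in>carrier_vec m. hom_inner d (A f) a = f \<bullet>c w)"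
      using w[unfolded L_def] by (simp add: w_def[THEN arg_cong[of _ _ "\<lambda>x. x \<in> carrier_vec m"]])
    fix v assume v: "v \<in> carrier_vec m \<and> (\<forall>f\<in>carrier_vec m. hom_inner d (A f) a = f \<bullet>c v)"
    have "conjugate v = conjugate w"
    proof (rule eq_vecI)
      fix i assume i: "i < dim_vec (conjugate w)"
      then have im: "i < m" by (simp add: w_def)
      have "unit_vec m i \<bullet>c v = unit_vec m i \<bullet>c w"
        using v w[of "unit_vec m i"] by (auto simp: L_def)
      then show "conjugate v $ i = conjugate w $ i"
        using im v by (simp add: w_def)
    qed (use v in \<open>auto simp: w_def\<close>)
    then show "v = w" by (metis conjugate_id)
  qed
qed

section \<open>Edge maps and certificates\<close>

text \<open>
  The linear map \<open>a \<mapsto> (u \<mapsto> C\<^sup>*(l \<otimes> a u))\<close> on intertwiners, given column by column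
  (see \<open>edge_map_mult_vec\<close>).
\<close>

definition edge_map :: "complex vec \<Rightarrow> complex mat \<Rightarrow> complex mat \<Rightarrow> complex mat" where
  "edge_map l C a = mat_of_cols (dim_col C)
     (map (\<lambda>j. mat_adjoint C *\<^sub>v (l \<otimes>\<^sub>v col a j)) [0..<dim_col a])"

lemma edge_map_mult_vec:
  assumes l: "l \<in> carrier_vec w" and C: "C \<in> carrier_mat (w * n) k"
    and a: "a \<in> carrier_mat n d" and u: "u \<in> carrier_vec d"
  shows "edge_map l C a *\<^sub>v u = mat_adjoint C *\<^sub>v (l \<otimes>\<^sub>v (a *\<^sub>v u))"
proof (rule eq_vecI)
  have Ca: "mat_adjoint C \<in> carrier_mat k (w * n)" by (rule mat_adjoint_carrier[OF C])
  show "dim_vec (edge_map l C a *\<^sub>v u) = dim_vec (mat_adjoint C *\<^sub>v (l \<otimes>\<^sub>v (a *\<^sub>v u)))"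
    using C Ca by (simp add: edge_map_def)
  have md: "p mod n < n" if "p < w * n" for p
    using that by (metis mod_less_divisor mult_0_right not_gr_zero not_less0)
  fix i assume "i < dim_vec (mat_adjoint C *\<^sub>v (l \<otimes>\<^sub>v (a *\<^sub>v u)))"
  then have i: "i < k" using Ca by simp
  define c where "c p = mat_adjoint C $$ (i, p) * l $ (p div n)" for p
  have entry: "(mat_adjoint C *\<^sub>v (l \<otimes>\<^sub>v x)) $ i = (\<Sum>p<w * n. c p * x $ (p mod n))"
    if "x \<in> carrier_vec n" for x
    using that l Ca i
    by (auto simp: scalar_prod_def tensor_vec_def c_def atLeast0LessThan mult.assoc intro!: sum.cong)
  have col_i: "edge_map l C a $$ (i, j) = (\<Sum>p<w * n. c p * a $$ (p mod n, j))" if "j < d" for j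
  proof -
    have "edge_map l C a $$ (i, j) = (mat_adjoint C *\<^sub>v (l \<otimes>\<^sub>v col a j)) $ i"
      using that i C a Ca by (simp add: edge_map_def mat_of_cols_index)
    also have "\<dots> = (\<Sum>p<w * n. c p * col a j $ (p mod n))"
      using a by (intro entry) auto
    also have "\<dots> = (\<Sum>p<w * n. c p * a $$ (p mod n, j))"
      using that a md by (intro sum.cong) auto
    finally show ?thesis .
  qed
  have "(edge_map l C a *\<^sub>v u) $ i = (\<Sum>j<d. edge_map l C a $$ (i, j) * u $ j)"
    using i C a u by (simp add: scalar_prod_def atLeast0LessThan edge_map_def)
  also have "\<dots> = (\<Sum>j<d. \<Sum>p<w * n. c p * a $$ (p mod n, j) * u $ j)"
    by (simp add: col_i sum_distrib_right)
  also have "\<dots> = (\<Sum>p<w * n. \<Sum>j<d. c p * a $$ (p mod n, j) * u $ j)"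
    by (rule sum.swap)
  also have "\<dots> = (\<Sum>p<w * n. c p * (a *\<^sub>v u) $ (p mod n))"
  proof (rule sum.cong[OF refl])
    fix p assume "p \<in> {..<w * n}"
    then have "(a *\<^sub>v u) $ (p mod n) = (\<Sum>j<d. a $$ (p mod n, j) * u $ j)"
      using a u md[of p] by (simp add: scalar_prod_def atLeast0LessThan)
    then show "(\<Sum>j<d. c p * a $$ (p mod n, j) * u $ j) = c p * (a *\<^sub>v u) $ (p mod n)"
      by (simp add: sum_distrib_left mult.assoc)
  qed
  also have "\<dots> = (mat_adjoint C *\<^sub>v (l \<otimes>\<^sub>v (a *\<^sub>v u))) $ i"
    using a u by (intro entry[symmetric]) auto
  finally show "(edge_map l C a *\<^sub>v u) $ i = (mat_adjoint C *\<^sub>v (l \<otimes>\<^sub>v (a *\<^sub>v u))) $ i" .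
qed

text \<open>
  \<open>K\<close> is the stabiliser, \<open>(d, \<tau>)\<close> its representation \<open>E\<close>; \<open>(D \<omega>, V \<omega>)\<close> are the
  representations of the ambient group indexed by \<open>\<Omega>\<close>; \<open>Ed\<close> is the edge set with source, target
  and intertwiner \<open>src\<close>, \<open>tgt\<close>, \<open>C\<close>; \<open>l\<close> is the vector at the base point; \<open>m\<close> is the
  dimension of the profile space \<open>F\<close>. The maps \<open>A \<omega>\<close> are constrained only on
  \<^term>\<open>carrier_vec m :: complex vec set\<close>.
\<close>

definition frame_profile_certificate ::
  "('g, 'r) monoid_scheme \<Rightarrow> nat \<Rightarrow> ('g \<Rightarrow> complex mat) \<Rightarrow>
   'w set \<Rightarrow> ('w \<Rightarrow> nat) \<Rightarrow> ('w \<Rightarrow> 'g \<Rightarrow> complex mat) \<Rightarrow>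
   'e set \<Rightarrow> ('e \<Rightarrow> 'w) \<Rightarrow> ('e \<Rightarrow> 'w) \<Rightarrow> ('e \<Rightarrow> complex mat) \<Rightarrow> complex vec \<Rightarrow>
   nat \<Rightarrow> ('w \<Rightarrow> complex vec \<Rightarrow> complex mat) \<Rightarrow> ('e \<Rightarrow> complex) \<Rightarrow> real \<Rightarrow> bool" where
  "frame_profile_certificate K d \<tau> \<Omega> D V Ed src tgt C l m A b lam \<longleftrightarrow>
     m \<noteq> 0 \<and>
     (\<forall>\<omega>\<in>\<Omega>. A \<omega> \<in> module_hom class_ring (module_vec TYPE(complex) m) (hom_space K d \<tau> (D \<omega>) (V \<omega>))) \<and>
     (\<forall>f\<in>carrier_vec m. finsum_vec TYPE(complex) m (\<lambda>\<omega>. hom_adjoint d m (A \<omega>) (A \<omega> f)) \<Omega> = f) \<and>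
     (\<forall>\<nu>\<in>\<Omega>. (\<Sum>e\<in>{e \<in> Ed. tgt e = \<nu>}. (cmod (b e))\<^sup>2) \<le> 1) \<and>
     lam > 0 \<and>
     (\<forall>\<nu>\<in>\<Omega>. \<forall>f\<in>carrier_vec m.
        finsum (module_mat TYPE(complex) (D \<nu>) d)
          (\<lambda>e. cnj (b e) \<cdot>\<^sub>m edge_map l (C e) (A (src e) f)) {e \<in> Ed. tgt e = \<nu>}
        = complex_of_real (sqrt lam) \<cdot>\<^sub>m A \<nu> f)"

definition profile_weight :: "nat \<Rightarrow> nat \<Rightarrow> ('w \<Rightarrow> complex vec \<Rightarrow> complex mat) \<Rightarrow> 'w \<Rightarrow> real" where
  "profile_weight d m A \<omega> = (frobenius_norm d m (A \<omega>))\<^sup>2"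

definition profile_Delta ::
  "nat \<Rightarrow> nat \<Rightarrow> 'w set \<Rightarrow> ('w \<Rightarrow> nat) \<Rightarrow> ('w \<Rightarrow> complex vec \<Rightarrow> complex mat) \<Rightarrow> real" where
  "profile_Delta d m \<Omega> D A = (\<Sum>\<omega>\<in>\<Omega>. (profile_weight d m A \<omega>)\<^sup>2 / real (D \<omega>))"

end

theory Submission
  imports Defs "HOL-Analysis.Convex"
begin

text \<open>
  Put \<open>V = \<Oplus>\<^sub>\<omega> V \<omega>\<close>. The map \<open>f \<otimes> u \<mapsto> (A \<omega> f u)\<^sub>\<omega>\<close> is an isometric embedding \<open>F \<otimes> E \<rightarrow> V\<close> with
  \<open>H\<close>-invariant image; let \<open>P x\<close> be the orthogonal projection onto the translate of that image by
  an element moving the base point to \<open>x\<close>, a projection of rank \<open>m d\<^sub>E\<close>. The operator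
  \<open>\<Gamma> : V \<rightarrow> W \<otimes> V\<close>, \<open>y \<mapsto> \<Sum>\<^sub>e b e C e y\<^bsub>tgt e\<^esub>\<close>, is a contraction, because edges with a common source
  have orthogonal images (by Schur's lemma when their targets differ), and the eigenvalue equation
  of the certificate says \<open>\<Gamma>\<^sup>* (l x \<otimes> P x) = \<surd>\<lambda> P x\<close>. Summing over a code and comparing
  Hilbert-Schmidt norms gives \<open>\<lambda> \<Sum>\<^sub>x\<^sub>y tr (P x P y) \<le> \<Sum>\<^sub>x\<^sub>y t x y tr (P x P y)\<close>, hence, as
  \<open>t \<le> s\<close> off the diagonal, \<open>(\<lambda> - s) \<parallel>\<Sum>\<^sub>x P x\<parallel>\<^sup>2 \<le> (1 - s) |code| m d\<^sub>E\<close>. In the other direction,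
  the \<open>\<omega>\<close>-th diagonal block of \<open>\<Sum>\<^sub>x P x\<close> has trace \<open>|code| d\<^sub>E q\<^sub>\<omega>\<close>, so by Cauchy-Schwarz
  \<open>\<parallel>\<Sum>\<^sub>x P x\<parallel>\<^sup>2 \<ge> |code|\<^sup>2 d\<^sub>E\<^sup>2 \<Delta>\<close>.
\<close>

section \<open>Gram matrices and contractions\<close>

text \<open>Coordinates live on arbitrary index sets, so that a direct sum is a \<open>Sigma\<close>
  set and a tensor product a product set, with no flattening to natural numbers. As with
  \<open>\<bullet>c\<close>, the first argument is the linear one.\<close>

definition ip :: "'i set \<Rightarrow> ('i \<Rightarrow> complex) \<Rightarrow> ('i \<Rightarrow> complex) \<Rightarrow> complex" where
  "ip I u v = (\<Sum>i\<in>I. u i * cnj (v i))"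

lemma ip_self: "ip I u u = complex_of_real (\<Sum>i\<in>I. (cmod (u i))\<^sup>2)"
  unfolding ip_def of_real_sum by (intro sum.cong refl) (simp only: complex_norm_square)

text \<open>A contraction has a contractive adjoint. With \<open>y\<close> the adjoint applied to
  \<open>z\<close> and \<open>g\<close> the image of \<open>y\<close>, expand the square of the norm
  of \<open>z - g\<close>, which is nonnegative. The cross term is the squared norm of
  \<open>y\<close>, and the squared norm of \<open>g\<close> is at most that, so the squared norm of
  \<open>y\<close> is bounded by that of \<open>z\<close>.\<close>

lemma contraction_adjoint:
  fixes \<Gamma> :: "'i \<Rightarrow> 'j \<Rightarrow> complex"
  assumes contr: "\<And>y. (\<Sum>i\<in>I. (cmod (\<Sum>j\<in>J. \<Gamma> i j * y j))\<^sup>2) \<le> (\<Sum>j\<in>J. (cmod (y j))\<^sup>2)"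
  shows "(\<Sum>j\<in>J. (cmod (\<Sum>i\<in>I. cnj (\<Gamma> i j) * z i))\<^sup>2) \<le> (\<Sum>i\<in>I. (cmod (z i))\<^sup>2)"
proof -
  define y where "y j = (\<Sum>i\<in>I. cnj (\<Gamma> i j) * z i)" for j
  define g where "g i = (\<Sum>j\<in>J. \<Gamma> i j * y j)" for i
  have "(\<Sum>i\<in>I. cnj (z i) * g i) = (\<Sum>j\<in>J. \<Sum>i\<in>I. cnj (z i) * (\<Gamma> i j * y j))"
    unfolding g_def sum_distrib_left by (rule sum.swap)
  also have "\<dots> = (\<Sum>j\<in>J. y j * cnj (y j))"
    unfolding y_def cnj_sum
    by (intro sum.cong refl) (simp add: sum_distrib_left sum_distrib_right ac_simps)
  finally have zg: "Re (\<Sum>i\<in>I. cnj (z i) * g i) = (\<Sum>j\<in>J. (cmod (y j))\<^sup>2)"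
    using ip_self[of J y] by (simp add: ip_def)
  have "(cmod (a - b))\<^sup>2 = (cmod a)\<^sup>2 - 2 * Re (cnj a * b) + (cmod b)\<^sup>2" for a b
    by (simp add: cmod_power2) (simp add: power2_eq_square algebra_simps)
  then have "(\<Sum>i\<in>I. (cmod (z i - g i))\<^sup>2)
      = (\<Sum>i\<in>I. (cmod (z i))\<^sup>2) - 2 * Re (\<Sum>i\<in>I. cnj (z i) * g i) + (\<Sum>i\<in>I. (cmod (g i))\<^sup>2)"
    by (simp only: sum.distrib sum_subtractf sum_distrib_left[symmetric] Re_sum)
  moreover have "0 \<le> (\<Sum>i\<in>I. (cmod (z i - g i))\<^sup>2)"
    by (simp add: sum_nonneg)
  moreover have "(\<Sum>i\<in>I. (cmod (g i))\<^sup>2) \<le> (\<Sum>j\<in>J. (cmod (y j))\<^sup>2)"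
    unfolding g_def by (rule contr)
  ultimately show ?thesis
    unfolding zg y_def[symmetric] by linarith
qed

text \<open>Both sides are the squared Hilbert-Schmidt norm of the sum over \<open>n\<close> of the
  rank-one operators built from \<open>w n\<close> and the adjoint of \<open>v n\<close>: entrywise
  on the left, as a trace on the right. The right side sees only the two Gram matrices, which makes
  tensor factors easy to insert.\<close>

lemma hilbert_schmidt_sum:
  fixes v :: "'n \<Rightarrow> 'j \<Rightarrow> complex" and w :: "'n \<Rightarrow> 'i \<Rightarrow> complex"
  shows "complex_of_real (\<Sum>j\<in>J. \<Sum>i\<in>I. (cmod (\<Sum>n\<in>N. cnj (v n j) * w n i))\<^sup>2)
    = (\<Sum>n\<in>N. \<Sum>n'\<in>N. cnj (ip J (v n) (v n')) * ip I (w n) (w n'))"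
proof -
  have "complex_of_real (\<Sum>j\<in>J. \<Sum>i\<in>I. (cmod (\<Sum>n\<in>N. cnj (v n j) * w n i))\<^sup>2)
      = (\<Sum>j\<in>J. \<Sum>i\<in>I. \<Sum>n\<in>N. \<Sum>n'\<in>N. (cnj (v n j) * w n i) * cnj (cnj (v n' j) * w n' i))"
    by (simp only: of_real_sum complex_norm_square cnj_sum sum_product)
  also have "\<dots> = (\<Sum>j\<in>J. \<Sum>n\<in>N. \<Sum>i\<in>I. \<Sum>n'\<in>N. (cnj (v n j) * w n i) * cnj (cnj (v n' j) * w n' i))"
    by (intro sum.cong refl, rule sum.swap)
  also have "\<dots> = (\<Sum>n\<in>N. \<Sum>j\<in>J. \<Sum>i\<in>I. \<Sum>n'\<in>N. (cnj (v n j) * w n i) * cnj (cnj (v n' j) * w n' i))"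
    by (rule sum.swap)
  also have "\<dots> = (\<Sum>n\<in>N. \<Sum>j\<in>J. \<Sum>n'\<in>N. \<Sum>i\<in>I. (cnj (v n j) * w n i) * cnj (cnj (v n' j) * w n' i))"
    by (intro sum.cong refl, rule sum.swap)
  also have "\<dots> = (\<Sum>n\<in>N. \<Sum>n'\<in>N. \<Sum>j\<in>J. \<Sum>i\<in>I. (cnj (v n j) * w n i) * cnj (cnj (v n' j) * w n' i))"
    by (intro sum.cong refl, rule sum.swap)
  also have "\<dots> = (\<Sum>n\<in>N. \<Sum>n'\<in>N. cnj (ip J (v n) (v n')) * ip I (w n) (w n'))"
    unfolding ip_def cnj_sum sum_product by (intro sum.cong refl) (simp add: ac_simps)
  finally show ?thesis .
qed

text \<open>\<open>\<parallel>\<Sum>\<^sub>n v n (v n)\<^sup>*\<parallel>\<^sup>2\<close> in the Hilbert-Schmidt norm, see \<open>gram_energy_eq\<close>.\<close>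

definition gram_energy :: "'j set \<Rightarrow> 'n set \<Rightarrow> ('n \<Rightarrow> 'j \<Rightarrow> complex) \<Rightarrow> real" where
  "gram_energy J N v = (\<Sum>n\<in>N. \<Sum>n'\<in>N. (cmod (ip J (v n) (v n')))\<^sup>2)"

lemma gram_energy_eq:
  "gram_energy J N v = (\<Sum>j\<in>J. \<Sum>j'\<in>J. (cmod (\<Sum>n\<in>N. cnj (v n j) * v n j'))\<^sup>2)"
proof -
  have "complex_of_real (\<Sum>j\<in>J. \<Sum>j'\<in>J. (cmod (\<Sum>n\<in>N. cnj (v n j) * v n j'))\<^sup>2)
      = complex_of_real (gram_energy J N v)"
    unfolding hilbert_schmidt_sum gram_energy_def of_real_sum
    by (intro sum.cong refl) (simp only: complex_norm_square mult.commute)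
  then show ?thesis by (simp only: of_real_eq_iff)
qed

text \<open>By \<open>eig\<close>, the adjoint of \<Gamma> sends the tensor product of
  \<open>a n\<close> and \<open>v n\<close> to \<open>c\<close> times \<open>v n\<close>. Applied to
  the columns of the sum of the rank-one operators of that tensor product against
  \<open>v n\<close>, it produces \<open>c\<close> times the sum whose squared norm is
  \<open>gram_energy\<close>. A contraction does not increase Hilbert-Schmidt norms, and Gram
  matrices multiply entrywise under tensor products.\<close>

lemma gram_contraction:
  fixes v :: "'n \<Rightarrow> 'j \<Rightarrow> complex" and a :: "'n \<Rightarrow> 'p \<Rightarrow> complex"
    and \<Gamma> :: "'p \<times> 'j \<Rightarrow> 'j \<Rightarrow> complex"
  assumes contr: "\<And>y. (\<Sum>i\<in>P \<times> J. (cmod (\<Sum>j\<in>J. \<Gamma> i j * y j))\<^sup>2) \<le> (\<Sum>j\<in>J. (cmod (y j))\<^sup>2)"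
    and eig: "\<And>n j. n \<in> N \<Longrightarrow> j \<in> J \<Longrightarrow>
      (\<Sum>(q, i)\<in>P \<times> J. cnj (\<Gamma> (q, i) j) * (a n q * v n i)) = complex_of_real c * v n j"
  shows "c\<^sup>2 * gram_energy J N v
    \<le> (\<Sum>n\<in>N. \<Sum>n'\<in>N. Re (ip P (a n) (a n')) * (cmod (ip J (v n) (v n')))\<^sup>2)"
proof -
  define w where "w n = (\<lambda>(q, i). a n q * v n i)" for n
  have w: "ip (P \<times> J) (w n) (w n') = ip P (a n) (a n') * ip J (v n) (v n')" for n n'
    unfolding ip_def w_def sum_product sum.cartesian_product
    by (intro sum.cong refl) (auto simp: ac_simps)
  \<comment> \<open>The inner sum over \<open>n\<close> is the entry in row \<open>i\<close> and
    column \<open>k\<close> of that operator, so this evaluates the adjoint of \<Gamma> on its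
    \<open>k\<close>-th column.\<close>
  have eigw: "(\<Sum>i\<in>P \<times> J. cnj (\<Gamma> i j) * (\<Sum>n\<in>N. cnj (v n k) * w n i))
      = complex_of_real c * (\<Sum>n\<in>N. cnj (v n k) * v n j)" if "j \<in> J" for j k
  proof -
    have "(\<Sum>i\<in>P \<times> J. cnj (\<Gamma> i j) * (\<Sum>n\<in>N. cnj (v n k) * w n i))
        = (\<Sum>n\<in>N. \<Sum>i\<in>P \<times> J. cnj (\<Gamma> i j) * (cnj (v n k) * w n i))"
      unfolding sum_distrib_left by (rule sum.swap)
    also have "\<dots> = (\<Sum>n\<in>N. cnj (v n k) * (\<Sum>i\<in>P \<times> J. cnj (\<Gamma> i j) * w n i))"
      by (simp add: sum_distrib_left ac_simps)
    also have "\<dots> = (\<Sum>n\<in>N. cnj (v n k) * (complex_of_real c * v n j))"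
      using eig[OF _ that] by (intro sum.cong refl) (simp add: w_def case_prod_unfold)
    finally show ?thesis by (simp add: sum_distrib_left ac_simps)
  qed
  have "c\<^sup>2 * gram_energy J N v
      = (\<Sum>k\<in>J. \<Sum>j\<in>J. (cmod (\<Sum>i\<in>P \<times> J. cnj (\<Gamma> i j) * (\<Sum>n\<in>N. cnj (v n k) * w n i)))\<^sup>2)"
    unfolding gram_energy_eq sum_distrib_left[of "c\<^sup>2"]
    by (intro sum.cong refl) (simp add: eigw norm_mult power_mult_distrib)
  also have "\<dots> \<le> (\<Sum>k\<in>J. \<Sum>i\<in>P \<times> J. (cmod (\<Sum>n\<in>N. cnj (v n k) * w n i))\<^sup>2)"
    by (intro sum_mono contraction_adjoint contr)
  \<comment> \<open>Passing through the complex numbers makes the complex identity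
    \<open>hilbert_schmidt_sum\<close> applicable to a real quantity.\<close>
  also have "\<dots> = Re (complex_of_real \<dots>)"
    by (rule Re_complex_of_real[symmetric])
  also have "\<dots> = (\<Sum>n\<in>N. \<Sum>n'\<in>N. Re (ip P (a n) (a n') * complex_of_real ((cmod (ip J (v n) (v n')))\<^sup>2)))"
    unfolding hilbert_schmidt_sum w Re_sum
    by (intro sum.cong refl) (simp only: complex_norm_square ac_simps)
  finally show ?thesis by simp
qed

text \<open>Drop all off-diagonal entries of the positive operator and apply Cauchy-Schwarz to the
  diagonal of each block. The sum squared on the left is the trace of the block at \<omega>, and
  \<open>card (B \<omega>)\<close> is the dimension of that block.\<close>

lemma gram_energy_block_lower_bound:
  fixes v :: "'n \<Rightarrow> 'w \<times> 'i \<Rightarrow> complex"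
  assumes fin: "finite \<Omega>" "\<And>\<omega>. \<omega> \<in> \<Omega> \<Longrightarrow> finite (B \<omega>)"
  shows "(\<Sum>\<omega>\<in>\<Omega>. (\<Sum>n\<in>N. \<Sum>i\<in>B \<omega>. (cmod (v n (\<omega>, i)))\<^sup>2)\<^sup>2 / real (card (B \<omega>)))
    \<le> gram_energy (Sigma \<Omega> B) N v"
proof -
  have "(\<Sum>\<omega>\<in>\<Omega>. (\<Sum>n\<in>N. \<Sum>i\<in>B \<omega>. (cmod (v n (\<omega>, i)))\<^sup>2)\<^sup>2 / real (card (B \<omega>)))
      \<le> (\<Sum>\<omega>\<in>\<Omega>. \<Sum>i\<in>B \<omega>. (\<Sum>n\<in>N. (cmod (v n (\<omega>, i)))\<^sup>2)\<^sup>2)"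
  proof (rule sum_mono)
    fix \<omega> assume "\<omega> \<in> \<Omega>"
    then have fB: "finite (B \<omega>)" by (rule fin)
    have "(\<Sum>n\<in>N. \<Sum>i\<in>B \<omega>. (cmod (v n (\<omega>, i)))\<^sup>2)\<^sup>2 = (\<Sum>i\<in>B \<omega>. \<Sum>n\<in>N. (cmod (v n (\<omega>, i)))\<^sup>2)\<^sup>2"
      by (subst sum.swap) (rule refl)
    also have "\<dots> \<le> (\<Sum>i\<in>B \<omega>. (\<Sum>n\<in>N. (cmod (v n (\<omega>, i)))\<^sup>2)\<^sup>2) * real (card (B \<omega>))"
      using sum_squared_le_sum_of_squares by blast
    finally show "(\<Sum>n\<in>N. \<Sum>i\<in>B \<omega>. (cmod (v n (\<omega>, i)))\<^sup>2)\<^sup>2 / real (card (B \<omega>))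
        \<le> (\<Sum>i\<in>B \<omega>. (\<Sum>n\<in>N. (cmod (v n (\<omega>, i)))\<^sup>2)\<^sup>2)"
      \<comment> \<open>For an empty block the quotient is a division by zero, hence 0.\<close>
      by (cases "card (B \<omega>) = 0") (simp_all add: sum_nonneg divide_le_eq)
  qed
  also have "\<dots> = (\<Sum>j\<in>Sigma \<Omega> B. (\<Sum>n\<in>N. (cmod (v n j))\<^sup>2)\<^sup>2)"
    using fin by (simp add: sum.Sigma case_prod_unfold)
  also have "\<dots> = (\<Sum>j\<in>Sigma \<Omega> B. (cmod (\<Sum>n\<in>N. cnj (v n j) * v n j))\<^sup>2)"
  proof (intro sum.cong refl)
    fix j
    have "(\<Sum>n\<in>N. cnj (v n j) * v n j) = complex_of_real (\<Sum>n\<in>N. (cmod (v n j))\<^sup>2)"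
      by (simp only: of_real_sum complex_norm_square mult.commute)
    then show "(\<Sum>n\<in>N. (cmod (v n j))\<^sup>2)\<^sup>2 = (cmod (\<Sum>n\<in>N. cnj (v n j) * v n j))\<^sup>2"
      by (simp only: norm_of_real power2_abs)
  qed
  also have "\<dots> \<le> (\<Sum>j\<in>Sigma \<Omega> B. \<Sum>j'\<in>Sigma \<Omega> B. (cmod (\<Sum>n\<in>N. cnj (v n j) * v n j'))\<^sup>2)"
  proof (rule sum_mono)
    have "finite (Sigma \<Omega> B)" using fin by simp
    then show "(cmod (\<Sum>n\<in>N. cnj (v n j) * v n j))\<^sup>2
        \<le> (\<Sum>j'\<in>Sigma \<Omega> B. (cmod (\<Sum>n\<in>N. cnj (v n j) * v n j'))\<^sup>2)" if "j \<in> Sigma \<Omega> B" for j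
      using that by (intro member_le_sum[of j _ "\<lambda>j'. (cmod (\<Sum>n\<in>N. cnj (v n j) * v n j'))\<^sup>2"]) auto
  qed
  finally show ?thesis by (simp only: gram_energy_eq)
qed

text \<open>Split the pairs according to whether they lie over the same point. Off the diagonal
  \<open>t\<close> is at most \<open>s\<close>; on it \<open>t\<close> equals 1, written as
  \<open>s + (1 - s)\<close>. The excess \<open>1 - s\<close> is then multiplied by the same-point
  energy, and orthonormality over each point makes every index contribute exactly 1 to that.\<close>

lemma gram_energy_upper_bound:
  fixes v :: "'x \<times> 'k \<Rightarrow> 'j \<Rightarrow> complex" and t :: "'x \<Rightarrow> 'x \<Rightarrow> real"
  assumes fin: "finite Y" "finite K"
    and orth: "\<And>x k k'. x \<in> Y \<Longrightarrow> k \<in> K \<Longrightarrow> k' \<in> K \<Longrightarrow>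
      ip J (v (x, k)) (v (x, k')) = (if k = k' then 1 else 0)"
    and le: "\<And>x y. x \<in> Y \<Longrightarrow> y \<in> Y \<Longrightarrow> x \<noteq> y \<Longrightarrow> t x y \<le> s"
    and one: "\<And>x. x \<in> Y \<Longrightarrow> t x x = 1"
    and lower: "lam * gram_energy J (Y \<times> K) v
      \<le> (\<Sum>n\<in>Y \<times> K. \<Sum>n'\<in>Y \<times> K. t (fst n) (fst n') * (cmod (ip J (v n) (v n')))\<^sup>2)"
  shows "(lam - s) * gram_energy J (Y \<times> K) v \<le> (1 - s) * (real (card Y) * real (card K))"
proof -
  let ?g = "\<lambda>n n'. (cmod (ip J (v n) (v n')))\<^sup>2"
  have diag: "(\<Sum>n'\<in>Y \<times> K. if fst n = fst n' then ?g n n' else 0) = 1" if n: "n \<in> Y \<times> K" for n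
  proof -
    obtain x k where [simp]: "n = (x, k)" and x: "x \<in> Y" and k: "k \<in> K" using n by auto
    have "(\<Sum>n'\<in>Y \<times> K. if fst n = fst n' then ?g n n' else 0)
        = (\<Sum>y\<in>Y. \<Sum>k'\<in>K. if x = y then ?g (x, k) (y, k') else 0)"
      unfolding sum.cartesian_product by (intro sum.cong refl) auto
    also have "\<dots> = (\<Sum>y\<in>Y. if x = y then \<Sum>k'\<in>K. ?g (x, k) (y, k') else 0)"
      by (intro sum.cong refl) simp
    also have "\<dots> = (\<Sum>k'\<in>K. ?g (x, k) (x, k'))"
      using fin x by simp
    also have "\<dots> = (\<Sum>k'\<in>K. if k = k' then 1 else 0)"
      using orth[OF x k] by (intro sum.cong refl) auto
    finally show ?thesis using fin k by simp
  qed
  have "(\<Sum>n\<in>Y \<times> K. \<Sum>n'\<in>Y \<times> K. t (fst n) (fst n') * ?g n n')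
      \<le> (\<Sum>n\<in>Y \<times> K. \<Sum>n'\<in>Y \<times> K. s * ?g n n' + (1 - s) * (if fst n = fst n' then ?g n n' else 0))"
  proof (intro sum_mono)
    fix n n' assume "n \<in> Y \<times> K" "n' \<in> Y \<times> K"
    then show "t (fst n) (fst n') * ?g n n'
        \<le> s * ?g n n' + (1 - s) * (if fst n = fst n' then ?g n n' else 0)"
      using mult_right_mono[OF le[of "fst n" "fst n'"], of "?g n n'"] one[of "fst n"]
      by (cases "fst n = fst n'") (auto simp: algebra_simps mem_Times_iff)
  qed
  also have "\<dots> = s * gram_energy J (Y \<times> K) v + (1 - s) * (\<Sum>n\<in>Y \<times> K. 1)"
    unfolding gram_energy_def sum.distrib sum_distrib_left[symmetric]
    using sum.cong[OF refl diag, of "Y \<times> K" "\<lambda>x. x"] by simp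
  also have "(\<Sum>n\<in>Y \<times> K. 1) = real (card Y) * real (card K)"
    by (simp add: card_cartesian_product)
  finally show ?thesis using lower by (simp add: left_diff_distrib)
qed

section \<open>Matrices and intertwiners\<close>

lemma cscalar_prod_eq_ip:
  "dim_vec w = n \<Longrightarrow> v \<bullet>c w = ip {..<n} (($) v) (($) w)"
  by (simp add: scalar_prod_def ip_def atLeast0LessThan)

lemma dim_mat_adjoint [simp]:
  "dim_row (mat_adjoint A) = dim_col A" "dim_col (mat_adjoint A) = dim_row A"
  by (simp_all add: mat_adjoint_def)

lemma mat_adjoint_mat_adjoint [simp]: "mat_adjoint (mat_adjoint A) = (A :: complex mat)"
  by (rule eq_matI) (simp_all add: mat_adjoint_index)

lemma mat_adjoint_mult:
  fixes A B :: "complex mat"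
  assumes "dim_col A = dim_row B"
  shows "mat_adjoint (A * B) = mat_adjoint B * mat_adjoint A"
  using assms
  by (intro eq_matI) (simp_all add: mat_adjoint_index scalar_prod_def mult.commute)

lemma div_mod_less:
  assumes "i < a * (b :: nat)"
  shows "i div b < a" "i mod b < b"
  using assms by (metis less_mult_imp_div_less mod_less_divisor mult_0_right not_gr_zero not_less0)+

lemma dim_tensor_mat [simp]:
  "dim_row (A \<otimes>\<^sub>m B) = dim_row A * dim_row B" "dim_col (A \<otimes>\<^sub>m B) = dim_col A * dim_col B"
  by (simp_all add: tensor_mat_def)

lemma tensor_mat_adjoint: "mat_adjoint (A \<otimes>\<^sub>m B) = mat_adjoint A \<otimes>\<^sub>m mat_adjoint B"
  by (rule eq_matI) (simp_all add: mat_adjoint_index tensor_mat_def div_mod_less)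

lemma tensor_mat_mult:
  assumes "dim_col A = dim_row A'" "dim_col B = dim_row B'"
  shows "(A \<otimes>\<^sub>m B) * (A' \<otimes>\<^sub>m B') = (A * A') \<otimes>\<^sub>m (B * B')"
proof (rule eq_matI)
  fix i j assume "i < dim_row ((A * A') \<otimes>\<^sub>m (B * B'))" "j < dim_col ((A * A') \<otimes>\<^sub>m (B * B'))"
  then have ij: "i < dim_row A * dim_row B" "j < dim_col A' * dim_col B'" by simp_all
  let ?f = "\<lambda>k l. (A $$ (i div dim_row B, k) * A' $$ (k, j div dim_col B'))
    * (B $$ (i mod dim_row B, l) * B' $$ (l, j mod dim_col B'))"
  have "((A \<otimes>\<^sub>m B) * (A' \<otimes>\<^sub>m B')) $$ (i, j)
      = (\<Sum>k<dim_row A' * dim_row B'. ?f (k div dim_row B') (k mod dim_row B'))"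
    using assms ij
    by (auto simp: scalar_prod_def tensor_mat_def atLeast0LessThan intro!: sum.cong)
  also have "\<dots> = (\<Sum>k<dim_row A'. \<Sum>l<dim_row B'. ?f k l)"
    by (rule sum_div_mod)
  also have "\<dots> = ((A * A') \<otimes>\<^sub>m (B * B')) $$ (i, j)"
    using assms ij
    by (simp add: tensor_mat_def div_mod_less scalar_prod_def atLeast0LessThan sum_product)
  finally show "((A \<otimes>\<^sub>m B) * (A' \<otimes>\<^sub>m B')) $$ (i, j) = ((A * A') \<otimes>\<^sub>m (B * B')) $$ (i, j)" .
qed simp_all

lemma tensor_mat_one: "1\<^sub>m a \<otimes>\<^sub>m 1\<^sub>m b = 1\<^sub>m (a * b)"
proof (rule eq_matI)
  fix i j assume "i < dim_row (1\<^sub>m (a * b) :: complex mat)" "j < dim_col (1\<^sub>m (a * b) :: complex mat)"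
  moreover have "i = j \<longleftrightarrow> i div b = j div b \<and> i mod b = j mod b"
    by (metis div_mult_mod_eq)
  ultimately show "(1\<^sub>m a \<otimes>\<^sub>m 1\<^sub>m b) $$ (i, j) = 1\<^sub>m (a * b) $$ (i, j)"
    by (simp add: tensor_mat_def div_mod_less)
qed simp_all

section \<open>Intertwiners and Schur's lemma\<close>

lemma intertwinersD:
  assumes "a \<in> intertwiners G n \<rho> k \<sigma>"
  shows "a \<in> carrier_mat k n" "g \<in> carrier G \<Longrightarrow> a * \<rho> g = \<sigma> g * a"
  using assms by (auto simp: intertwiners_def)

lemma intertwiners_mult:
  assumes a: "a \<in> intertwiners G n \<rho> k \<sigma>" and b: "b \<in> intertwiners G k \<sigma> j \<kappa>"
    and dim: "\<And>g. g \<in> carrier G \<Longrightarrow> \<rho> g \<in> carrier_mat n n"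
      "\<And>g. g \<in> carrier G \<Longrightarrow> \<sigma> g \<in> carrier_mat k k" "\<And>g. g \<in> carrier G \<Longrightarrow> \<kappa> g \<in> carrier_mat j j"
  shows "b * a \<in> intertwiners G n \<rho> j \<kappa>"
proof -
  note ac = intertwinersD[OF a] and bc = intertwinersD[OF b]
  have "b * a * \<rho> g = \<kappa> g * (b * a)" if g: "g \<in> carrier G" for g
  proof -
    have "b * a * \<rho> g = b * (\<sigma> g * a)"
      using assoc_mult_mat[OF bc(1) ac(1) dim(1)[OF g]] ac(2)[OF g] by simp
    also have "\<dots> = \<kappa> g * b * a"
      using assoc_mult_mat[OF bc(1) dim(2)[OF g] ac(1)] bc(2)[OF g] by simp
    finally show ?thesis
      using assoc_mult_mat[OF dim(3)[OF g] bc(1) ac(1)] by simp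
  qed
  then show ?thesis using ac(1) bc(1) by (auto simp: intertwiners_def)
qed

text \<open>Inserting the product of \<open>\<rho> g\<close> with its adjoint and cancelling on the
  side of \<sigma> gives the intertwining relation for the adjoints of the group matrices; taking
  adjoints finishes. The hypotheses are matrix identities rather than \<open>unitary_rep\<close>, so
  that \<open>W g \<otimes>\<^sub>m V \<omega> g\<close> qualifies without being shown to be a
  homomorphism.\<close>

lemma intertwiners_adjoint:
  assumes a: "a \<in> intertwiners G n \<rho> k \<sigma>"
    and \<rho>: "\<And>g. g \<in> carrier G \<Longrightarrow> \<rho> g \<in> carrier_mat n n"
      "\<And>g. g \<in> carrier G \<Longrightarrow> \<rho> g * mat_adjoint (\<rho> g) = 1\<^sub>m n"
    and \<sigma>: "\<And>g. g \<in> carrier G \<Longrightarrow> \<sigma> g \<in> carrier_mat k k"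
      "\<And>g. g \<in> carrier G \<Longrightarrow> mat_adjoint (\<sigma> g) * \<sigma> g = 1\<^sub>m k"
  shows "mat_adjoint a \<in> intertwiners G k \<sigma> n \<rho>"
proof -
  note ac = intertwinersD[OF a]
  have "mat_adjoint a * \<sigma> g = \<rho> g * mat_adjoint a" if g: "g \<in> carrier G" for g
  proof -
    note r = \<rho>(1)[OF g] and s = \<sigma>(1)[OF g]
    note r' = mat_adjoint_carrier[OF r] and s' = mat_adjoint_carrier[OF s]
    have "mat_adjoint (\<sigma> g) * a = mat_adjoint (\<sigma> g) * (a * (\<rho> g * mat_adjoint (\<rho> g)))"
      using ac(1) \<rho>(2)[OF g] by simp
    also have "\<dots> = mat_adjoint (\<sigma> g) * ((\<sigma> g * a) * mat_adjoint (\<rho> g))"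
      using assoc_mult_mat[OF ac(1) r r'] ac(2)[OF g] by simp
    also have "\<dots> = mat_adjoint (\<sigma> g) * \<sigma> g * (a * mat_adjoint (\<rho> g))"
      using assoc_mult_mat[OF s ac(1) r'] assoc_mult_mat[OF s' s mult_carrier_mat[OF ac(1) r']] by simp
    also have "\<dots> = a * mat_adjoint (\<rho> g)"
      using \<sigma>(2)[OF g] ac(1) r' by simp
    finally have "mat_adjoint (mat_adjoint (\<sigma> g) * a) = mat_adjoint (a * mat_adjoint (\<rho> g))"
      by simp
    then show ?thesis using ac(1) r s by (simp add: mat_adjoint_mult)
  qed
  then show ?thesis using mat_adjoint_carrier[OF ac(1)] by (simp add: intertwiners_def)
qed

lemma schur_mat:
  assumes irr: "irreducible_rep G d \<tau>" and un: "unitary_rep G d \<tau>"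
    and N: "N \<in> intertwiners G d \<tau> d \<tau>"
  obtains c where "N = c \<cdot>\<^sub>m 1\<^sub>m d"
proof -
  note Nc = intertwinersD[OF N]
  have "N *\<^sub>v (\<tau> g *\<^sub>v u) = \<tau> g *\<^sub>v (N *\<^sub>v u)" if "g \<in> carrier G" "u \<in> carrier_vec d" for g u
    using that Nc unitary_repD(1)[OF un] by (metis assoc_mult_mat_vec)
  then obtain c where c: "\<And>u. u \<in> carrier_vec d \<Longrightarrow> N *\<^sub>v u = c \<cdot>\<^sub>v u"
    using schur[OF irr un Nc(1)] by blast
  have "N $$ (i, j) = (c \<cdot>\<^sub>m 1\<^sub>m d) $$ (i, j)" if "i < d" "j < d" for i j
  proof -
    have "N $$ (i, j) = (N *\<^sub>v unit_vec d j) $ i"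
      using that Nc(1) by simp
    then show ?thesis using that by (simp add: c unit_vec_def)
  qed
  then have "N = c \<cdot>\<^sub>m 1\<^sub>m d"
    using Nc(1) by (intro eq_matI) auto
  then show ?thesis by (rule that)
qed

text \<open>The diagonal entries of the product are the squared norms of the columns of
  \<open>P\<close>.\<close>

lemma mat_adjoint_self_mult_eq_0:
  fixes P :: "complex mat"
  assumes P: "P \<in> carrier_mat k n" and 0: "mat_adjoint P * P = 0\<^sub>m n n"
  shows "P = 0\<^sub>m k n"
proof (rule eq_matI)
  fix i j assume "i < dim_row (0\<^sub>m k n :: complex mat)" "j < dim_col (0\<^sub>m k n :: complex mat)"
  then have ij: "i < k" "j < n" by simp_all
  have "(\<Sum>r<k. (cmod (P $$ (r, j)))\<^sup>2) = 0"
  proof -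
    have "complex_of_real (\<Sum>r<k. (cmod (P $$ (r, j)))\<^sup>2) = (mat_adjoint P * P) $$ (j, j)"
      using P ij
      by (simp add: scalar_prod_def atLeast0LessThan mat_adjoint_index complex_norm_square mult.commute
          del: of_real_power)
    then show ?thesis using 0 ij by (simp del: of_real_sum)
  qed
  then show "P $$ (i, j) = 0\<^sub>m k n $$ (i, j)"
    using ij by (simp add: sum_nonneg_eq_0_iff)
qed (use P in auto)

text \<open>Schur's lemma between different representations, obtained from the scalar case. The two
  products of \<open>P\<close> with its adjoint are scalars \<open>c\<close> and \<open>c'\<close>.
  If \<open>P\<close> is nonzero then so is \<open>c\<close>, and bracketing the triple product of
  \<open>P\<close>, its adjoint and \<open>P\<close> in two ways forces \<open>c' = c\<close>. The
  adjoint divided by \<open>c\<close> then inverts \<open>P\<close> and makes the representations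
  equivalent.\<close>

lemma intertwiner_inequivalent_eq_0:
  assumes irr: "irreducible_rep G n \<rho>" "irreducible_rep G k \<sigma>"
    and un: "unitary_rep G n \<rho>" "unitary_rep G k \<sigma>"
    and P: "P \<in> intertwiners G n \<rho> k \<sigma>" and neq: "\<not> equivalent_reps G n \<rho> k \<sigma>"
  shows "P = 0\<^sub>m k n"
proof (rule ccontr)
  assume P0: "P \<noteq> 0\<^sub>m k n"
  note r = unitary_repD[OF un(1)] and s = unitary_repD[OF un(2)]
  let ?Q = "mat_adjoint P"
  have Q: "?Q \<in> intertwiners G k \<sigma> n \<rho>"
    by (rule intertwiners_adjoint[OF P r(1,3) s(1,2)])
  note Pc = intertwinersD(1)[OF P] and Qc = intertwinersD(1)[OF Q]
  obtain c where c: "?Q * P = c \<cdot>\<^sub>m 1\<^sub>m n"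
    using schur_mat[OF irr(1) un(1) intertwiners_mult[OF P Q r(1) s(1) r(1)]] .
  obtain c' where c': "P * ?Q = c' \<cdot>\<^sub>m 1\<^sub>m k"
    using schur_mat[OF irr(2) un(2) intertwiners_mult[OF Q P s(1) r(1) s(1)]] .
  have "c \<noteq> 0"
  proof
    assume "c = 0"
    then have "?Q * P = 0\<^sub>m n n" unfolding c by (intro eq_matI) auto
    then show False using mat_adjoint_self_mult_eq_0[OF Pc] P0 by blast
  qed
  have "c' \<cdot>\<^sub>m P = P * ?Q * P"
    using c' Pc mult_smult_assoc_mat[of "1\<^sub>m k" k k P n c'] by simp
  also have "\<dots> = P * (?Q * P)"
    by (rule assoc_mult_mat[OF Pc Qc Pc])
  also have "\<dots> = c \<cdot>\<^sub>m P"
    using c Pc mult_smult_distrib[OF Pc one_carrier_mat, of c] by simp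
  finally have eq: "c' \<cdot>\<^sub>m P = c \<cdot>\<^sub>m P" .
  have "(c' - c) * P $$ (i, j) = 0" if "i < k" "j < n" for i j
    using that Pc arg_cong[OF eq, of "\<lambda>M. M $$ (i, j)"] by (simp add: algebra_simps)
  then have "c' = c"
    using P0 Pc by (auto simp: mat_eq_iff)
  define R where "R = (1 / c) \<cdot>\<^sub>m ?Q"
  have "(1 / c) \<cdot>\<^sub>m (c \<cdot>\<^sub>m 1\<^sub>m j) = 1\<^sub>m j" for j
    using \<open>c \<noteq> 0\<close> by (intro eq_matI) auto
  then have "R * P = 1\<^sub>m n" "P * R = 1\<^sub>m k"
    using c c' \<open>c' = c\<close>
    by (simp_all add: R_def mult_smult_assoc_mat[OF Qc Pc] mult_smult_distrib[OF Pc Qc])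
  moreover have "R \<in> carrier_mat n k" using Qc by (simp add: R_def)
  ultimately show False
    using neq P by (auto simp: equivalent_reps_def)
qed

section \<open>The edge operator\<close>

text \<open>The matrix of \<open>\<Oplus>\<^sub>\<nu> V \<nu> \<rightarrow> W \<otimes> (\<Oplus>\<^sub>\<omega> V \<omega>)\<close>, \<open>y \<mapsto> \<Sum>\<^sub>e b e \<cdot> C e (y (tgt e))\<close>; the rows of
  \<open>C e\<close> are indexed lexicographically.\<close>

definition edge_operator ::
  "'e set \<Rightarrow> ('e \<Rightarrow> 'w) \<Rightarrow> ('e \<Rightarrow> 'w) \<Rightarrow> ('w \<Rightarrow> nat) \<Rightarrow> ('e \<Rightarrow> complex mat) \<Rightarrow> ('e \<Rightarrow> complex)
    \<Rightarrow> nat \<times> 'w \<times> nat \<Rightarrow> 'w \<times> nat \<Rightarrow> complex" where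
  "edge_operator Ed src tgt D C b = (\<lambda>(q, \<omega>, i) (\<nu>, r).
     \<Sum>e\<in>{e \<in> Ed. src e = \<omega> \<and> tgt e = \<nu>}. b e * C e $$ (q * D \<omega> + i, r))"

abbreviation (input) block_index :: "'w set \<Rightarrow> ('w \<Rightarrow> nat) \<Rightarrow> ('w \<times> nat) set" where
  "block_index \<Omega> D \<equiv> Sigma \<Omega> (\<lambda>\<omega>. {..<D \<omega>})"

lemma sum_Sigma_fibre:
  assumes "finite \<Omega>" "\<And>\<omega>. \<omega> \<in> \<Omega> \<Longrightarrow> finite (B \<omega>)" "\<nu> \<in> \<Omega>"
  shows "(\<Sum>j\<in>Sigma \<Omega> B. if fst j = \<nu> then f j else 0) = (\<Sum>r\<in>B \<nu>. f (\<nu>, r))"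
proof -
  have "(\<Sum>j\<in>Sigma \<Omega> B. if fst j = \<nu> then f j else 0)
      = (\<Sum>\<omega>\<in>\<Omega>. \<Sum>r\<in>B \<omega>. if \<omega> = \<nu> then f (\<omega>, r) else 0)"
    using assms by (subst sum.Sigma) (auto intro!: sum.cong)
  also have "\<dots> = (\<Sum>\<omega>\<in>\<Omega>. if \<omega> = \<nu> then \<Sum>r\<in>B \<omega>. f (\<omega>, r) else 0)"
    by (intro sum.cong refl) simp
  finally show ?thesis using assms by simp
qed

lemma mult_add_less: "q < a \<Longrightarrow> i < b \<Longrightarrow> q * b + i < a * (b :: nat)"
  using mult_le_mono1[of "Suc q" a b] by simp

text \<open>The parallel edges from \<omega> to \<nu>, taken over all \<nu>, are exactly the edges
  leaving \<omega>, so the sum over blocks becomes a sum over outgoing edges, each reading the block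
  of \<open>y\<close> at its target.\<close>

lemma edge_operator_apply:
  assumes fin: "finite \<Omega>" "finite Ed" and tgt: "\<And>e. e \<in> Ed \<Longrightarrow> tgt e \<in> \<Omega>"
    and C: "\<And>e. e \<in> Ed \<Longrightarrow> C e \<in> carrier_mat (a * D (src e)) (D (tgt e))"
    and qi: "q < a" "i < D \<omega>"
  shows "(\<Sum>j\<in>block_index \<Omega> D. edge_operator Ed src tgt D C b (q, \<omega>, i) j * y j)
    = (\<Sum>e\<in>{e \<in> Ed. src e = \<omega>}.
        b e * (C e *\<^sub>v vec (D (tgt e)) (\<lambda>r. y (tgt e, r))) $ (q * D \<omega> + i))"
proof -
  let ?E = "{e \<in> Ed. src e = \<omega>}" and ?J = "block_index \<Omega> D"
  have "(\<Sum>j\<in>?J. edge_operator Ed src tgt D C b (q, \<omega>, i) j * y j)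
      = (\<Sum>j\<in>?J. \<Sum>e\<in>?E. if fst j = tgt e then b e * C e $$ (q * D \<omega> + i, snd j) * y j else 0)"
  proof (intro sum.cong refl)
    fix j :: "'a \<times> nat"
    have "{e \<in> Ed. src e = \<omega> \<and> tgt e = fst j} = {e \<in> ?E. fst j = tgt e}" by auto
    then show "edge_operator Ed src tgt D C b (q, \<omega>, i) j * y j
        = (\<Sum>e\<in>?E. if fst j = tgt e then b e * C e $$ (q * D \<omega> + i, snd j) * y j else 0)"
      using fin(2)
      by (simp add: edge_operator_def case_prod_unfold sum_distrib_right sum.If_cases Int_def)
  qed
  also have "\<dots> = (\<Sum>e\<in>?E. \<Sum>j\<in>?J. if fst j = tgt e then b e * C e $$ (q * D \<omega> + i, snd j) * y j else 0)"
    by (rule sum.swap)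
  also have "\<dots> = (\<Sum>e\<in>?E. \<Sum>r<D (tgt e). b e * C e $$ (q * D \<omega> + i, r) * y (tgt e, r))"
    using fin tgt by (intro sum.cong refl) (simp add: sum_Sigma_fibre)
  also have "\<dots> = (\<Sum>e\<in>?E. b e * (C e *\<^sub>v vec (D (tgt e)) (\<lambda>r. y (tgt e, r))) $ (q * D \<omega> + i))"
  proof (intro sum.cong refl)
    fix e assume e: "e \<in> ?E"
    then have "C e \<in> carrier_mat (a * D \<omega>) (D (tgt e))" using C by auto
    then show "(\<Sum>r<D (tgt e). b e * C e $$ (q * D \<omega> + i, r) * y (tgt e, r))
        = b e * (C e *\<^sub>v vec (D (tgt e)) (\<lambda>r. y (tgt e, r))) $ (q * D \<omega> + i)"
      using mult_add_less[OF qi]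
      by (simp add: scalar_prod_def atLeast0LessThan sum_distrib_left mult.assoc)
  qed
  finally show ?thesis .
qed

text \<open>On the adjoint side a block at \<nu> collects the edges entering \<nu>. The result has
  the shape of the left side of the certificate's eigenvalue equation.\<close>

lemma edge_operator_adjoint_apply:
  assumes fin: "finite \<Omega>" "finite Ed" and src: "\<And>e. e \<in> Ed \<Longrightarrow> src e \<in> \<Omega>"
    and C: "\<And>e. e \<in> Ed \<Longrightarrow> C e \<in> carrier_mat (a * D (src e)) (D (tgt e))"
    and w: "w \<in> carrier_vec a" and r: "r < D \<nu>"
  shows "(\<Sum>(q, i)\<in>{..<a} \<times> block_index \<Omega> D.
      cnj (edge_operator Ed src tgt D C b (q, i) (\<nu>, r)) * (w $ q * y i))
    = (\<Sum>e\<in>{e \<in> Ed. tgt e = \<nu>}.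
        cnj (b e) * (mat_adjoint (C e) *\<^sub>v (w \<otimes>\<^sub>v vec (D (src e)) (\<lambda>i. y (src e, i)))) $ r)"
proof -
  let ?E = "{e \<in> Ed. tgt e = \<nu>}" and ?J = "block_index \<Omega> D"
  let ?f = "\<lambda>e q j. cnj (b e * C e $$ (q * D (src e) + snd j, r)) * (w $ q * y j)"
  have "(\<Sum>(q, i)\<in>{..<a} \<times> ?J. cnj (edge_operator Ed src tgt D C b (q, i) (\<nu>, r)) * (w $ q * y i))
      = (\<Sum>q<a. \<Sum>j\<in>?J. \<Sum>e\<in>?E. if fst j = src e then ?f e q j else 0)"
    unfolding sum.cartesian_product[symmetric]
  proof (intro sum.cong refl)
    fix q and j :: "'a \<times> nat"
    have "{e \<in> Ed. src e = fst j \<and> tgt e = \<nu>} = {e \<in> ?E. fst j = src e}" by auto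
    then have "cnj (edge_operator Ed src tgt D C b (q, j) (\<nu>, r)) * (w $ q * y j)
        = (\<Sum>e\<in>{e \<in> ?E. fst j = src e}. cnj (b e * C e $$ (q * D (fst j) + snd j, r)) * (w $ q * y j))"
      by (simp add: edge_operator_def case_prod_unfold sum_distrib_right)
    also have "\<dots> = (\<Sum>e\<in>{e \<in> ?E. fst j = src e}. ?f e q j)"
      by (intro sum.cong refl) simp
    also have "\<dots> = (\<Sum>e\<in>?E. if fst j = src e then ?f e q j else 0)"
      using fin(2) by (simp add: sum.If_cases Int_def)
    finally show "cnj (edge_operator Ed src tgt D C b (q, j) (\<nu>, r)) * (w $ q * y j)
        = (\<Sum>e\<in>?E. if fst j = src e then ?f e q j else 0)" .
  qed
  also have "\<dots> = (\<Sum>q<a. \<Sum>e\<in>?E. \<Sum>j\<in>?J. if fst j = src e then ?f e q j else 0)"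
    by (intro sum.cong refl, rule sum.swap)
  also have "\<dots> = (\<Sum>e\<in>?E. \<Sum>q<a. \<Sum>j\<in>?J. if fst j = src e then ?f e q j else 0)"
    by (rule sum.swap)
  also have "\<dots> = (\<Sum>e\<in>?E. \<Sum>q<a. \<Sum>i<D (src e). ?f e q (src e, i))"
    using fin src by (intro sum.cong refl) (simp add: sum_Sigma_fibre)
  also have "\<dots> = (\<Sum>e\<in>?E.
      cnj (b e) * (mat_adjoint (C e) *\<^sub>v (w \<otimes>\<^sub>v vec (D (src e)) (\<lambda>i. y (src e, i)))) $ r)"
  proof (intro sum.cong refl)
    fix e assume e: "e \<in> ?E"
    let ?n = "D (src e)"
    from e C have Ce: "C e \<in> carrier_mat (a * ?n) (D \<nu>)" by auto
    let ?h = "\<lambda>q i. cnj (C e $$ (q * ?n + i, r)) * (w $ q * y (src e, i))"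
    have "(mat_adjoint (C e) *\<^sub>v (w \<otimes>\<^sub>v vec ?n (\<lambda>i. y (src e, i)))) $ r
        = (\<Sum>p<a * ?n. ?h (p div ?n) (p mod ?n))"
      using Ce w r mat_adjoint_carrier[OF Ce]
      by (auto simp: scalar_prod_def tensor_vec_def atLeast0LessThan mat_adjoint_index div_mod_less
          intro!: sum.cong)
    also have "\<dots> = (\<Sum>q<a. \<Sum>i<?n. ?h q i)"
      by (rule sum_div_mod)
    finally show "(\<Sum>q<a. \<Sum>i<?n. ?f e q (src e, i))
        = cnj (b e) * (mat_adjoint (C e) *\<^sub>v (w \<otimes>\<^sub>v vec ?n (\<lambda>i. y (src e, i)))) $ r"
      by (simp add: sum_distrib_left mult.assoc)
  qed
  finally show ?thesis .
qed

lemma sum_orthogonal_norm_square: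
  assumes fin: "finite E"
    and orth: "\<And>e e'. e \<in> E \<Longrightarrow> e' \<in> E \<Longrightarrow> e \<noteq> e' \<Longrightarrow> ip I (u e) (u e') = 0"
  shows "(\<Sum>i\<in>I. (cmod (\<Sum>e\<in>E. u e i))\<^sup>2) = (\<Sum>e\<in>E. \<Sum>i\<in>I. (cmod (u e i))\<^sup>2)"
proof -
  \<comment> \<open>With a one-point \<open>J\<close> and \<open>v\<close> constantly 1, the Gram
    matrix of \<open>v\<close> is all ones and only that of \<open>u\<close> remains.\<close>
  have "complex_of_real (\<Sum>i\<in>I. (cmod (\<Sum>e\<in>E. u e i))\<^sup>2) = (\<Sum>e\<in>E. \<Sum>e'\<in>E. ip I (u e) (u e'))"
    using hilbert_schmidt_sum[where v = "\<lambda>_ _. 1" and w = u and J = "{()}" and N = E and I = I]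
    by (simp add: ip_def)
  also have "\<dots> = (\<Sum>e\<in>E. \<Sum>e'\<in>E. if e = e' then ip I (u e) (u e) else 0)"
    using orth by (intro sum.cong refl) auto
  also have "\<dots> = complex_of_real (\<Sum>e\<in>E. \<Sum>i\<in>I. (cmod (u e i))\<^sup>2)"
    using fin by (simp add: ip_self)
  finally show ?thesis by (simp only: of_real_eq_iff)
qed

text \<open>Orthogonality acts at common sources, the bound on \<open>b\<close> at common targets.
  In the block at \<omega> the contributions of the outgoing edges are orthogonal, and since each
  \<open>C e\<close> is isometric, the squared norms add up to those of the blocks \<open>y\<close>
  at \<open>tgt e\<close>, weighted by the squares of \<open>cmod (b e)\<close>. Regrouped by
  target, the weights at each vertex sum to at most 1.\<close>

lemma edge_operator_contraction:
  assumes fin: "finite \<Omega>" "finite Ed"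
    and src: "\<And>e. e \<in> Ed \<Longrightarrow> src e \<in> \<Omega>" and tgt: "\<And>e. e \<in> Ed \<Longrightarrow> tgt e \<in> \<Omega>"
    and C: "\<And>e. e \<in> Ed \<Longrightarrow> C e \<in> carrier_mat (a * D (src e)) (D (tgt e))"
    and iso: "\<And>e. e \<in> Ed \<Longrightarrow> mat_adjoint (C e) * C e = 1\<^sub>m (D (tgt e))"
    and orth: "\<And>e e' u v. e \<in> Ed \<Longrightarrow> e' \<in> Ed \<Longrightarrow> e \<noteq> e' \<Longrightarrow> src e = src e' \<Longrightarrow>
      u \<in> carrier_vec (D (tgt e)) \<Longrightarrow> v \<in> carrier_vec (D (tgt e')) \<Longrightarrow> (C e *\<^sub>v u) \<bullet>c (C e' *\<^sub>v v) = 0"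
    and b: "\<And>\<nu>. \<nu> \<in> \<Omega> \<Longrightarrow> (\<Sum>e\<in>{e \<in> Ed. tgt e = \<nu>}. (cmod (b e))\<^sup>2) \<le> 1"
  shows "(\<Sum>i\<in>{..<a} \<times> block_index \<Omega> D.
      (cmod (\<Sum>j\<in>block_index \<Omega> D. edge_operator Ed src tgt D C b i j * y j))\<^sup>2)
    \<le> (\<Sum>j\<in>block_index \<Omega> D. (cmod (y j))\<^sup>2)"
proof -
  let ?J = "block_index \<Omega> D"
  define yv where "yv \<nu> = vec (D \<nu>) (\<lambda>r. y (\<nu>, r))" for \<nu>
  define u where "u e = (\<lambda>p. b e * (C e *\<^sub>v yv (tgt e)) $ p)" for e
  have uip: "ip {..<a * D (src e)} (u e) (u e')
      = b e * cnj (b e') * ((C e *\<^sub>v yv (tgt e)) \<bullet>c (C e' *\<^sub>v yv (tgt e')))"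
    if "e \<in> Ed" "e' \<in> Ed" "src e = src e'" for e e'
    using that C[of e'] by (simp add: cscalar_prod_eq_ip ip_def u_def sum_distrib_left ac_simps)
  have unorm: "(\<Sum>p<a * D (src e). (cmod (u e p))\<^sup>2) = (cmod (b e))\<^sup>2 * (\<Sum>r<D (tgt e). (cmod (y (tgt e, r)))\<^sup>2)"
    if e: "e \<in> Ed" for e
  proof -
    have yc: "yv (tgt e) \<in> carrier_vec (D (tgt e))" by (simp add: yv_def)
    have "(C e *\<^sub>v yv (tgt e)) \<bullet>c (C e *\<^sub>v yv (tgt e))
        = yv (tgt e) \<bullet>c ((mat_adjoint (C e) * C e) *\<^sub>v yv (tgt e))"
      using mat_adjoint_inner[OF C[OF e] yc, of "C e *\<^sub>v yv (tgt e)"] C[OF e] yc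
        assoc_mult_mat_vec[OF mat_adjoint_carrier[OF C[OF e]] C[OF e] yc] by simp
    also have "\<dots> = ip {..<D (tgt e)} (\<lambda>r. y (tgt e, r)) (\<lambda>r. y (tgt e, r))"
      using yc by (simp add: iso[OF e] cscalar_prod_eq_ip) (simp add: ip_def yv_def)
    finally have "complex_of_real (\<Sum>p<a * D (src e). (cmod (u e p))\<^sup>2)
        = b e * cnj (b e) * complex_of_real (\<Sum>r<D (tgt e). (cmod (y (tgt e, r)))\<^sup>2)"
      using uip[OF e e] by (simp only: ip_self)
    also have "\<dots> = complex_of_real ((cmod (b e))\<^sup>2 * (\<Sum>r<D (tgt e). (cmod (y (tgt e, r)))\<^sup>2))"
      by (simp only: complex_norm_square[symmetric] of_real_mult)
    finally show ?thesis by (simp only: of_real_eq_iff)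
  qed
  have "(\<Sum>i\<in>{..<a} \<times> ?J. (cmod (\<Sum>j\<in>?J. edge_operator Ed src tgt D C b i j * y j))\<^sup>2)
      = (\<Sum>q<a. \<Sum>\<omega>\<in>\<Omega>. \<Sum>i<D \<omega>. (cmod (\<Sum>j\<in>?J. edge_operator Ed src tgt D C b (q, \<omega>, i) j * y j))\<^sup>2)"
    using fin by (simp add: sum.Sigma sum.cartesian_product case_prod_unfold)
  also have "\<dots> = (\<Sum>q<a. \<Sum>\<omega>\<in>\<Omega>. \<Sum>i<D \<omega>. (cmod (\<Sum>e\<in>{e \<in> Ed. src e = \<omega>}. u e (q * D \<omega> + i)))\<^sup>2)"
    using edge_operator_apply[OF fin tgt C] by (intro sum.cong refl) (simp add: u_def yv_def)
  also have "\<dots> = (\<Sum>\<omega>\<in>\<Omega>. \<Sum>q<a. \<Sum>i<D \<omega>. (cmod (\<Sum>e\<in>{e \<in> Ed. src e = \<omega>}. u e (q * D \<omega> + i)))\<^sup>2)"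
    by (rule sum.swap)
  also have "\<dots> = (\<Sum>\<omega>\<in>\<Omega>. \<Sum>p<a * D \<omega>. (cmod (\<Sum>e\<in>{e \<in> Ed. src e = \<omega>}. u e p))\<^sup>2)"
  proof (rule sum.cong[OF refl])
    fix \<omega>
    show "(\<Sum>q<a. \<Sum>i<D \<omega>. (cmod (\<Sum>e\<in>{e \<in> Ed. src e = \<omega>}. u e (q * D \<omega> + i)))\<^sup>2)
        = (\<Sum>p<a * D \<omega>. (cmod (\<Sum>e\<in>{e \<in> Ed. src e = \<omega>}. u e p))\<^sup>2)"
      using sum_div_mod[of "\<lambda>q i. (cmod (\<Sum>e\<in>{e \<in> Ed. src e = \<omega>}. u e (q * D \<omega> + i)))\<^sup>2" "D \<omega>" a]
      by simp
  qed
  also have "\<dots> = (\<Sum>\<omega>\<in>\<Omega>. \<Sum>e\<in>{e \<in> Ed. src e = \<omega>}. \<Sum>p<a * D \<omega>. (cmod (u e p))\<^sup>2)"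
  proof (rule sum.cong[OF refl], rule sum_orthogonal_norm_square)
    fix \<omega> e e' assume "e \<in> {e \<in> Ed. src e = \<omega>}" "e' \<in> {e \<in> Ed. src e = \<omega>}" "e \<noteq> e'"
    then show "ip {..<a * D \<omega>} (u e) (u e') = 0"
      using uip[of e e'] orth[of e e' "yv (tgt e)" "yv (tgt e')"] by (simp add: yv_def)
  qed (use fin in simp)
  also have "\<dots> = (\<Sum>\<omega>\<in>\<Omega>. \<Sum>e\<in>{e \<in> Ed. src e = \<omega>}. (cmod (b e))\<^sup>2 * (\<Sum>r<D (tgt e). (cmod (y (tgt e, r)))\<^sup>2))"
    using unorm by (intro sum.cong refl) auto
  also have "\<dots> = (\<Sum>e\<in>Ed. (cmod (b e))\<^sup>2 * (\<Sum>r<D (tgt e). (cmod (y (tgt e, r)))\<^sup>2))"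
    using fin src by (intro sum.group) auto
  also have "\<dots> = (\<Sum>\<nu>\<in>\<Omega>. \<Sum>e\<in>{e \<in> Ed. tgt e = \<nu>}. (cmod (b e))\<^sup>2 * (\<Sum>r<D (tgt e). (cmod (y (tgt e, r)))\<^sup>2))"
    using fin tgt by (intro sum.group[symmetric]) auto
  also have "\<dots> = (\<Sum>\<nu>\<in>\<Omega>. (\<Sum>e\<in>{e \<in> Ed. tgt e = \<nu>}. (cmod (b e))\<^sup>2) * (\<Sum>r<D \<nu>. (cmod (y (\<nu>, r)))\<^sup>2))"
    unfolding sum_distrib_right by (intro sum.cong refl) auto
  also have "\<dots> \<le> (\<Sum>\<nu>\<in>\<Omega>. 1 * (\<Sum>r<D \<nu>. (cmod (y (\<nu>, r)))\<^sup>2))"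
    by (intro sum_mono mult_right_mono b) (auto simp: sum_nonneg)
  also have "\<dots> = (\<Sum>j\<in>?J. (cmod (y j))\<^sup>2)"
    using fin by (simp add: sum.Sigma case_prod_unfold)
  finally show ?thesis .
qed

section \<open>Profiles\<close>

lemma unitary_rep_restrict:
  assumes "unitary_rep G n \<rho>" "S \<subseteq> carrier G"
  shows "unitary_rep (G\<lparr>carrier := S\<rparr>) n \<rho>"
  using assms by (auto simp: unitary_rep_def hom_def)

text \<open>Covers two edges with a common source and different targets: the adjoint of
  \<open>C\<close> times \<open>C'\<close> intertwines inequivalent irreducible representations, so
  it vanishes.\<close>

lemma edge_images_orthogonal:
  assumes un: "\<And>\<omega>. \<omega> \<in> \<Omega> \<Longrightarrow> unitary_rep G (D \<omega>) (V \<omega>)"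
    and irr: "\<And>\<omega>. \<omega> \<in> \<Omega> \<Longrightarrow> irreducible_rep G (D \<omega>) (V \<omega>)"
    and neq: "\<And>\<omega> \<nu>. \<omega> \<in> \<Omega> \<Longrightarrow> \<nu> \<in> \<Omega> \<Longrightarrow> \<omega> \<noteq> \<nu> \<Longrightarrow>
      \<not> equivalent_reps G (D \<omega>) (V \<omega>) (D \<nu>) (V \<nu>)"
    and \<sigma>: "\<And>g. g \<in> carrier G \<Longrightarrow> \<sigma> g \<in> carrier_mat N N"
      "\<And>g. g \<in> carrier G \<Longrightarrow> mat_adjoint (\<sigma> g) * \<sigma> g = 1\<^sub>m N"
    and mem: "\<nu> \<in> \<Omega>" "\<nu>' \<in> \<Omega>" "\<nu> \<noteq> \<nu>'"
    and C: "C \<in> intertwiners G (D \<nu>) (V \<nu>) N \<sigma>" and C': "C' \<in> intertwiners G (D \<nu>') (V \<nu>') N \<sigma>"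
    and u: "u \<in> carrier_vec (D \<nu>)" and v: "v \<in> carrier_vec (D \<nu>')"
  shows "(C *\<^sub>v u) \<bullet>c (C' *\<^sub>v v) = 0"
proof -
  note V = unitary_repD[OF un[OF mem(1)]] and V' = unitary_repD[OF un[OF mem(2)]]
  note Cc = intertwinersD(1)[OF C] and C'c = intertwinersD(1)[OF C']
  have "mat_adjoint C * C' \<in> intertwiners G (D \<nu>') (V \<nu>') (D \<nu>) (V \<nu>)"
    by (rule intertwiners_mult[OF C' intertwiners_adjoint[OF C V(1,3) \<sigma>] V'(1) \<sigma>(1) V(1)])
  then have "mat_adjoint C * C' = 0\<^sub>m (D \<nu>) (D \<nu>')"
    by (rule intertwiner_inequivalent_eq_0[OF irr[OF mem(2)] irr[OF mem(1)] un[OF mem(2)] un[OF mem(1)] _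
          neq[OF mem(2,1) mem(3)[symmetric]]])
  moreover have zero: "0\<^sub>m (D \<nu>) (D \<nu>') *\<^sub>v v = 0\<^sub>v (D \<nu>)"
    using v by (intro eq_vecI) auto
  ultimately have "mat_adjoint C *\<^sub>v (C' *\<^sub>v v) = 0\<^sub>v (D \<nu>)"
    using assoc_mult_mat_vec[OF mat_adjoint_carrier[OF Cc] C'c v] zero v by simp
  then show ?thesis
    using mat_adjoint_inner[OF Cc u, of "C' *\<^sub>v v"] C'c u v by auto
qed

text \<open>Translates the certificate's eigenvalue equation, a \<open>finsum\<close> in the module
  of matrices, into ordinary sums of entries.\<close>

lemma finsum_mat_mult_vec:
  fixes M :: "'e \<Rightarrow> 'a :: comm_ring_1 mat"
  assumes "finite F" and M: "\<And>e. e \<in> F \<Longrightarrow> M e \<in> carrier_mat nr nc"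
    and u: "u \<in> carrier_vec nc" and p: "p < nr"
  shows "(finsum (module_mat TYPE('a) nr nc) M F *\<^sub>v u) $ p = (\<Sum>e\<in>F. (M e *\<^sub>v u) $ p)"
  using assms(1) M
proof (induction F)
  case empty
  interpret abelian_group "module_mat TYPE('a) nr nc" by (rule abelian_group_mat)
  show ?case using u p by (simp add: module_mat_simps)
next
  case (insert e F)
  interpret abelian_group "module_mat TYPE('a) nr nc" by (rule abelian_group_mat)
  have MF: "M \<in> F \<rightarrow> carrier (module_mat TYPE('a) nr nc)" "M e \<in> carrier (module_mat TYPE('a) nr nc)"
    using insert.prems by (auto simp: module_mat_simps)
  have sc: "finsum (module_mat TYPE('a) nr nc) M F \<in> carrier_mat nr nc"
    using finsum_closed[OF MF(1)] by (simp add: module_mat_simps)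
  have "finsum (module_mat TYPE('a) nr nc) M (insert e F)
      = M e + finsum (module_mat TYPE('a) nr nc) M F"
    using finsum_insert[OF insert.hyps MF] by (simp add: module_mat_simps)
  then show ?case
    using insert sc u p by (simp add: add_mult_distrib_mat_vec[of _ nr nc])
qed

lemma inner_finsum_vec:
  fixes v :: "'w \<Rightarrow> complex vec"
  assumes fin: "finite \<Omega>" and v: "\<And>\<omega>. \<omega> \<in> \<Omega> \<Longrightarrow> v \<omega> \<in> carrier_vec n"
  shows "f \<bullet>c finsum_vec TYPE(complex) n v \<Omega> = (\<Sum>\<omega>\<in>\<Omega>. f \<bullet>c v \<omega>)"
proof -
  have "finsum_vec TYPE(complex) n v \<Omega> \<in> carrier_vec n"
    using v by (intro finsum_vec_closed) auto
  then have "f \<bullet>c finsum_vec TYPE(complex) n v \<Omega> = (\<Sum>i<n. \<Sum>\<omega>\<in>\<Omega>. f $ i * cnj (v \<omega> $ i))"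
    using fin v by (simp add: cscalar_prod_eq_ip ip_def index_finsum_vec sum_distrib_left)
  also have "\<dots> = (\<Sum>\<omega>\<in>\<Omega>. \<Sum>i<n. f $ i * cnj (v \<omega> $ i))"
    by (rule sum.swap)
  also have "\<dots> = (\<Sum>\<omega>\<in>\<Omega>. f \<bullet>c v \<omega>)"
    using v by (intro sum.cong refl) (simp add: cscalar_prod_eq_ip[of _ n] ip_def)
  finally show ?thesis .
qed

text \<open>The resolution of the identity in weak form: pair it with \<open>f\<close> and move each
  adjoint back. Equivalently, sending \<open>f\<close> to the family of all
  \<open>A \<omega> f\<close> is an isometry.\<close>

lemma sum_hom_inner_partition:
  assumes irr: "irreducible_rep K d \<tau>" and un\<tau>: "unitary_rep K d \<tau>"
    and un: "\<And>\<omega>. \<omega> \<in> \<Omega> \<Longrightarrow> unitary_rep K (D \<omega>) (V \<omega>)" and fin: "finite \<Omega>"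
    and A: "\<And>\<omega>. \<omega> \<in> \<Omega> \<Longrightarrow>
      A \<omega> \<in> module_hom class_ring (module_vec TYPE(complex) m) (hom_space K d \<tau> (D \<omega>) (V \<omega>))"
    and part: "\<And>f. f \<in> carrier_vec m \<Longrightarrow>
      finsum_vec TYPE(complex) m (\<lambda>\<omega>. hom_adjoint d m (A \<omega>) (A \<omega> f)) \<Omega> = f"
    and f: "f \<in> carrier_vec m" "f' \<in> carrier_vec m"
  shows "(\<Sum>\<omega>\<in>\<Omega>. hom_inner d (A \<omega> f) (A \<omega> f')) = f \<bullet>c f'"
proof -
  have adj: "hom_adjoint d m (A \<omega>) (A \<omega> f') \<in> carrier_vec m"
      "hom_inner d (A \<omega> f) (A \<omega> f') = f \<bullet>c hom_adjoint d m (A \<omega>) (A \<omega> f')" if "\<omega> \<in> \<Omega>" for \<omega>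
  proof -
    have "A \<omega> f' \<in> intertwiners K d \<tau> (D \<omega>) (V \<omega>)"
      using module_hom_closed[OF A[OF that]] f by (auto simp: hom_space_def module_vec_simps)
    from theI'[OF hom_adjoint_unique[OF irr un\<tau> un[OF that] A[OF that] this], folded hom_adjoint_def] f
    show "hom_adjoint d m (A \<omega>) (A \<omega> f') \<in> carrier_vec m"
      "hom_inner d (A \<omega> f) (A \<omega> f') = f \<bullet>c hom_adjoint d m (A \<omega>) (A \<omega> f')" by blast+
  qed
  show ?thesis
    using adj inner_finsum_vec[OF fin, of "\<lambda>\<omega>. hom_adjoint d m (A \<omega>) (A \<omega> f')" m f] part[OF f(2)]
    by simp
qed

lemma unit_vec_inner:
  "i < n \<Longrightarrow> j < n \<Longrightarrow> unit_vec n i \<bullet>c (unit_vec n j :: complex vec) = (if i = j then 1 else 0)"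
  by (simp add: cscalar_prod_eq_ip ip_def unit_vec_def if_distrib cong: if_cong)

theorem theorem6p4:
  fixes G :: "('g, 'r) monoid_scheme"
    and X :: "'x set" and \<phi> :: "'g \<Rightarrow> 'x \<Rightarrow> 'x" and x0 :: 'x
    and dW :: nat and W :: "'g \<Rightarrow> complex mat"
    and l :: "'x \<Rightarrow> complex vec" and t :: "'x \<Rightarrow> 'x \<Rightarrow> real"
    and dE :: nat and \<tau> :: "'g \<Rightarrow> complex mat"
    and \<Omega> :: "'w set" and D :: "'w \<Rightarrow> nat" and V :: "'w \<Rightarrow> 'g \<Rightarrow> complex mat"
    and Ed :: "'e set" and src tgt :: "'e \<Rightarrow> 'w" and C :: "'e \<Rightarrow> complex mat"
    and m :: nat and A :: "'w \<Rightarrow> complex vec \<Rightarrow> complex mat" and b :: "'e \<Rightarrow> complex"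
    and lam s :: real and code :: "'x set"
  defines "H \<equiv> G\<lparr>carrier := stabilizer G \<phi> x0\<rparr>"
  assumes "group G" and "finite (carrier G)"
    and "finite X" and "transitive_action G X \<phi>" and "x0 \<in> X"
    and "unitary_rep G dW W"
    and "\<And>x. x \<in> X \<Longrightarrow> l x \<in> carrier_vec dW"
    and "\<And>g x. g \<in> carrier G \<Longrightarrow> x \<in> X \<Longrightarrow> l (\<phi> g x) = W g *\<^sub>v l x"
    and "\<And>x. x \<in> X \<Longrightarrow> l x \<bullet>c l x = 1"
    and "\<And>x y. x \<in> X \<Longrightarrow> y \<in> X \<Longrightarrow> l x \<bullet>c l y = complex_of_real (t x y)"
    and "unitary_rep H dE \<tau>" and "irreducible_rep H dE \<tau>"
    and "finite \<Omega>" and "\<Omega> \<noteq> {}"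
    and "\<And>\<omega>. \<omega> \<in> \<Omega> \<Longrightarrow> unitary_rep G (D \<omega>) (V \<omega>)"
    and "\<And>\<omega>. \<omega> \<in> \<Omega> \<Longrightarrow> irreducible_rep G (D \<omega>) (V \<omega>)"
    and "\<And>\<omega> \<nu>. \<omega> \<in> \<Omega> \<Longrightarrow> \<nu> \<in> \<Omega> \<Longrightarrow> \<omega> \<noteq> \<nu> \<Longrightarrow>
           \<not> equivalent_reps G (D \<omega>) (V \<omega>) (D \<nu>) (V \<nu>)"
    and "finite Ed"
    and "\<And>e. e \<in> Ed \<Longrightarrow> src e \<in> \<Omega>" and "\<And>e. e \<in> Ed \<Longrightarrow> tgt e \<in> \<Omega>"
    and "\<And>e. e \<in> Ed \<Longrightarrow> C e \<in> intertwiners G (D (tgt e)) (V (tgt e))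
           (dW * D (src e)) (\<lambda>g. W g \<otimes>\<^sub>m V (src e) g)"
    and "\<And>e. e \<in> Ed \<Longrightarrow> mat_adjoint (C e) * C e = 1\<^sub>m (D (tgt e))"
    and "\<And>e e' u v. e \<in> Ed \<Longrightarrow> e' \<in> Ed \<Longrightarrow> e \<noteq> e' \<Longrightarrow> src e = src e' \<Longrightarrow> tgt e = tgt e' \<Longrightarrow>
           u \<in> carrier_vec (D (tgt e)) \<Longrightarrow> v \<in> carrier_vec (D (tgt e)) \<Longrightarrow>
           (C e *\<^sub>v u) \<bullet>c (C e' *\<^sub>v v) = 0"
    and "frame_profile_certificate H dE \<tau> \<Omega> D V Ed src tgt C (l x0) m A b lam"
    and "lam > max s 0"
    and "code \<subseteq> X"
    and "\<And>x y. x \<in> code \<Longrightarrow> y \<in> code \<Longrightarrow> x \<noteq> y \<Longrightarrow> t x y \<le> s"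
  shows "real (card code) \<le>
           (1 - s) * real m / (real dE * (lam - s) * profile_Delta dE m \<Omega> D A)"
proof -
  note finX = assms(4) and x0 = assms(6) and unW = assms(7) and l_carrier = assms(8)
    and l_equiv = assms(9) and l_norm = assms(10) and lt = assms(11)
    and un\<tau> = assms(12) and irr\<tau> = assms(13) and fin\<Omega> = assms(14)
    and unV = assms(16) and irrV = assms(17) and neqV = assms(18) and finE = assms(19)
    and src = assms(20) and tgt = assms(21) and C = assms(22) and isoC = assms(23)
    and orthC = assms(24) and cert = assms(25) and lam = assms(26)
    and code_sub = assms(27) and code_le = assms(28)
  let ?J = "block_index \<Omega> D" and ?K = "{..<m} \<times> {..<dE}"
  let ?U = "\<lambda>i. unit_vec m i :: complex vec" and ?E = "\<lambda>j. unit_vec dE j :: complex vec"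
  interpret act: transitive_action G X \<phi> by fact
  have "stabilizer G \<phi> x0 \<subseteq> carrier G"
    by (auto simp: stabilizer_def)
  then have unH: "unitary_rep H (D \<omega>) (V \<omega>)" if "\<omega> \<in> \<Omega>" for \<omega>
    unfolding H_def using unV[OF that] by (intro unitary_rep_restrict)
  have dE: "0 < dE" using irr\<tau> by (simp add: irreducible_rep_def)
  from cert have m: "0 < m" and lam0: "0 < lam"
    and A: "\<And>\<omega>. \<omega> \<in> \<Omega> \<Longrightarrow>
      A \<omega> \<in> module_hom class_ring (module_vec TYPE(complex) m) (hom_space H dE \<tau> (D \<omega>) (V \<omega>))"
    and part: "\<And>f. f \<in> carrier_vec m \<Longrightarrow>
      finsum_vec TYPE(complex) m (\<lambda>\<omega>. hom_adjoint dE m (A \<omega>) (A \<omega> f)) \<Omega> = f"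
    and b: "\<And>\<nu>. \<nu> \<in> \<Omega> \<Longrightarrow> (\<Sum>e\<in>{e \<in> Ed. tgt e = \<nu>}. (cmod (b e))\<^sup>2) \<le> 1"
    and eig: "\<And>\<nu> f. \<nu> \<in> \<Omega> \<Longrightarrow> f \<in> carrier_vec m \<Longrightarrow>
        finsum (module_mat TYPE(complex) (D \<nu>) dE)
          (\<lambda>e. cnj (b e) \<cdot>\<^sub>m edge_map (l x0) (C e) (A (src e) f)) {e \<in> Ed. tgt e = \<nu>}
        = complex_of_real (sqrt lam) \<cdot>\<^sub>m A \<nu> f"
    by (auto simp: frame_profile_certificate_def)

  \<comment> \<open>Translated profile vectors and their orthonormality\<close>
  have AM: "A \<omega> f \<in> intertwiners H dE \<tau> (D \<omega>) (V \<omega>)" if "\<omega> \<in> \<Omega>" "f \<in> carrier_vec m" for \<omega> f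
    using module_hom_closed[OF A[OF that(1)]] that(2) by (auto simp: hom_space_def module_vec_simps)
  note Ac = intertwinersD(1)[OF AM]
  \<comment> \<open>A section of the orbit map, by transitivity; \<open>g x0\<close> may be any
    element of the stabilizer.\<close>
  obtain g where g: "\<And>x. x \<in> X \<Longrightarrow> g x \<in> carrier G" "\<And>x. x \<in> X \<Longrightarrow> \<phi> (g x) x0 = x"
    using act.unique_orbit[OF x0] by metis
  \<comment> \<open>For \<open>k = (i, j)\<close>, \<open>a \<omega> k\<close> is the
    \<omega>-component of the image of the basis vector of the tensor product of \<open>F\<close>
    and \<open>E\<close> with index \<open>(i, j)\<close>, and \<open>v (x, k)\<close> is the whole
    image translated by \<open>g x\<close>. For fixed \<open>x\<close> these will be an orthonormal
    basis of the range of the projection at \<open>x\<close>.\<close>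
  define a where "a \<omega> k = A \<omega> (?U (fst k)) *\<^sub>v ?E (snd k)" for \<omega> k
  define v where "v n = (\<lambda>(\<omega>, r). (V \<omega> (g (fst n)) *\<^sub>v a \<omega> (snd n)) $ r)" for n
  have ac: "a \<omega> k \<in> carrier_vec (D \<omega>)" if "\<omega> \<in> \<Omega>" for \<omega> k
    unfolding a_def using Ac[OF that, of "?U (fst k)"] by auto
  have Vc: "V \<omega> (g x) \<in> carrier_mat (D \<omega>) (D \<omega>)" if "\<omega> \<in> \<Omega>" "x \<in> X" for \<omega> x
    using unitary_repD(1)[OF unV[OF that(1)] g(1)[OF that(2)]] .
  have vvec: "vec (D \<omega>) (\<lambda>r. v (x, k) (\<omega>, r)) = V \<omega> (g x) *\<^sub>v a \<omega> k" if "\<omega> \<in> \<Omega>" "x \<in> X" for \<omega> x k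
    using Vc[OF that] by (intro eq_vecI) (auto simp: v_def)
  \<comment> \<open>The translation is unitary and drops out. The isometry of evaluation then
    separates the index of \<open>F\<close> from that of \<open>E\<close>.\<close>
  have block: "(\<Sum>r<D \<omega>. v (x, k) (\<omega>, r) * cnj (v (x, k') (\<omega>, r)))
      = hom_inner dE (A \<omega> (?U (fst k))) (A \<omega> (?U (fst k'))) * (if snd k = snd k' then 1 else 0)"
    if "\<omega> \<in> \<Omega>" "x \<in> X" "k \<in> ?K" "k' \<in> ?K" for \<omega> x k k'
  proof -
    have "(\<Sum>r<D \<omega>. v (x, k) (\<omega>, r) * cnj (v (x, k') (\<omega>, r)))
        = (V \<omega> (g x) *\<^sub>v a \<omega> k) \<bullet>c (V \<omega> (g x) *\<^sub>v a \<omega> k')"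
      using Vc[OF that(1,2)] by (simp add: cscalar_prod_eq_ip[of _ "D \<omega>"] ip_def v_def)
    also have "\<dots> = a \<omega> k \<bullet>c a \<omega> k'"
      using that ac by (intro unitary_rep_inner[OF unV] g)
    also have "\<dots> = hom_inner dE (A \<omega> (?U (fst k))) (A \<omega> (?U (fst k'))) * (?E (snd k) \<bullet>c ?E (snd k'))"
      unfolding a_def using that(1) by (intro hom_inner_eq[OF irr\<tau> un\<tau> unH AM AM]) auto
    finally show ?thesis using that unit_vec_inner by auto
  qed
  have orth: "ip ?J (v (x, k)) (v (x, k')) = (if k = k' then 1 else 0)"
    if "x \<in> X" "k \<in> ?K" "k' \<in> ?K" for x k k'
  proof -
    have "ip ?J (v (x, k)) (v (x, k')) = (\<Sum>\<omega>\<in>\<Omega>. \<Sum>r<D \<omega>. v (x, k) (\<omega>, r) * cnj (v (x, k') (\<omega>, r)))"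
      unfolding ip_def using fin\<Omega> by (subst sum.Sigma) (auto simp: case_prod_unfold)
    also have "\<dots> = (\<Sum>\<omega>\<in>\<Omega>. hom_inner dE (A \<omega> (?U (fst k))) (A \<omega> (?U (fst k')))) * (if snd k = snd k' then 1 else 0)"
      unfolding sum_distrib_right using that by (intro sum.cong refl block)
    also have "\<dots> = (?U (fst k) \<bullet>c ?U (fst k')) * (if snd k = snd k' then 1 else 0)"
      using sum_hom_inner_partition[OF irr\<tau> un\<tau> unH fin\<Omega> A part, of "?U (fst k)" "?U (fst k')"] by simp
    finally show ?thesis using that unit_vec_inner[of "fst k" m "fst k'"] by (auto simp: prod_eq_iff)
  qed

  \<comment> \<open>The edge operator of the certificate is a contraction\<close>
  have Cc: "C e \<in> carrier_mat (dW * D (src e)) (D (tgt e))" if "e \<in> Ed" for e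
    using intertwinersD(1)[OF C[OF that]] .
  have WVc: "W h \<otimes>\<^sub>m V \<omega> h \<in> carrier_mat (dW * D \<omega>) (dW * D \<omega>)"
      "mat_adjoint (W h \<otimes>\<^sub>m V \<omega> h) * (W h \<otimes>\<^sub>m V \<omega> h) = 1\<^sub>m (dW * D \<omega>)"
    if h: "h \<in> carrier G" and \<omega>: "\<omega> \<in> \<Omega>" for h \<omega>
  proof -
    note w = unitary_repD[OF unW h] and r = unitary_repD[OF unV[OF \<omega>] h]
    show "W h \<otimes>\<^sub>m V \<omega> h \<in> carrier_mat (dW * D \<omega>) (dW * D \<omega>)"
      using w(1) r(1) by auto
    show "mat_adjoint (W h \<otimes>\<^sub>m V \<omega> h) * (W h \<otimes>\<^sub>m V \<omega> h) = 1\<^sub>m (dW * D \<omega>)"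
      using w r by (simp add: tensor_mat_adjoint tensor_mat_mult tensor_mat_one)
  qed
  have edge_orth: "(C e *\<^sub>v u) \<bullet>c (C e' *\<^sub>v u') = 0"
    if "e \<in> Ed" "e' \<in> Ed" "e \<noteq> e'" "src e = src e'"
      "u \<in> carrier_vec (D (tgt e))" "u' \<in> carrier_vec (D (tgt e'))" for e e' u u'
  proof (cases "tgt e = tgt e'")
    case True
    then show ?thesis using that by (intro orthC) auto
  next
    case False
    show ?thesis
      by (rule edge_images_orthogonal[of \<Omega> G D V "\<lambda>h. W h \<otimes>\<^sub>m V (src e) h" "dW * D (src e)"
            "tgt e" "tgt e'"])
        (use that False unV irrV neqV WVc src tgt C[of e] C[of e'] in auto)
  qed
  note contr = edge_operator_contraction[OF fin\<Omega> finE src tgt Cc isoC edge_orth b]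

  \<comment> \<open>The eigenvalue equation, transported from the base point to every point\<close>
  have edge_equiv: "mat_adjoint (C e) *\<^sub>v (l x \<otimes>\<^sub>v (V (src e) (g x) *\<^sub>v a (src e) k))
      = V (tgt e) (g x) *\<^sub>v (edge_map (l x0) (C e) (A (src e) (?U (fst k))) *\<^sub>v ?E (snd k))"
    if e: "e \<in> Ed" and x: "x \<in> X" for e x k
  proof -
    let ?h = "g x" and ?\<omega> = "src e"
    note h = g(1)[OF x] and \<omega> = src[OF e]
    note Ca = mat_adjoint_carrier[OF Cc[OF e]]
    have lx: "l x = W ?h *\<^sub>v l x0" using l_equiv[OF h x0] g(2)[OF x] by simp
    have lc: "l x0 \<otimes>\<^sub>v a ?\<omega> k \<in> carrier_vec (dW * D ?\<omega>)"
      using l_carrier[OF x0] ac[OF \<omega>] by (intro carrier_vecI) (simp add: tensor_vec_def)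
    have "l x \<otimes>\<^sub>v (V ?\<omega> ?h *\<^sub>v a ?\<omega> k) = (W ?h \<otimes>\<^sub>m V ?\<omega> ?h) *\<^sub>v (l x0 \<otimes>\<^sub>v a ?\<omega> k)"
      unfolding lx using unitary_repD(1)[OF unW h] Vc[OF \<omega> x] l_carrier[OF x0] ac[OF \<omega>]
      by (intro tensor_mat_mult_vec[symmetric]) auto
    \<comment> \<open>The adjoint of \<open>C e\<close> is an intertwiner too, so the translation by
      \<open>g x\<close> passes from the source side to the target side and only vectors at
      \<open>x0\<close> remain inside.\<close>
    moreover have "mat_adjoint (C e) * (W ?h \<otimes>\<^sub>m V ?\<omega> ?h) = V (tgt e) ?h * mat_adjoint (C e)"
      using unitary_repD[OF unV[OF tgt[OF e]]] WVc[OF _ \<omega>]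
      by (intro intertwinersD(2)[OF intertwiners_adjoint[OF C[OF e]] h])
    ultimately have "mat_adjoint (C e) *\<^sub>v (l x \<otimes>\<^sub>v (V ?\<omega> ?h *\<^sub>v a ?\<omega> k))
        = V (tgt e) ?h *\<^sub>v (mat_adjoint (C e) *\<^sub>v (l x0 \<otimes>\<^sub>v a ?\<omega> k))"
      using assoc_mult_mat_vec[OF Ca WVc(1)[OF h \<omega>] lc]
        assoc_mult_mat_vec[OF Vc[OF tgt[OF e] x] Ca lc] by simp
    then show ?thesis
      using edge_map_mult_vec[OF l_carrier[OF x0] Cc[OF e] Ac[OF \<omega>, of "?U (fst k)"], of "?E (snd k)"]
      by (simp add: a_def)
  qed
  \<comment> \<open>This is the hypothesis \<open>eig\<close> of \<open>gram_contraction\<close>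
    with \<open>c = sqrt lam\<close>. The certificate's equation is evaluated on a basis vector of
    \<open>E\<close>, and \<open>V \<nu> (g x)\<close> is then pulled out of the edge sum by
    linearity.\<close>
  have eigv: "(\<Sum>(q, i)\<in>{..<dW} \<times> ?J. cnj (edge_operator Ed src tgt D C b (q, i) j) * (l (fst n) $ q * v n i))
      = complex_of_real (sqrt lam) * v n j" if n: "n \<in> X \<times> ?K" and j: "j \<in> ?J" for n j
  proof -
    obtain x k where [simp]: "n = (x, k)" and x: "x \<in> X" and k: "k \<in> ?K" using n by blast
    obtain \<nu> r where [simp]: "j = (\<nu>, r)" and \<nu>: "\<nu> \<in> \<Omega>" and r: "r < D \<nu>" using j by blast
    let ?F = "{e \<in> Ed. tgt e = \<nu>}"
    let ?M = "\<lambda>e. edge_map (l x0) (C e) (A (src e) (?U (fst k)))"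
    have Mc: "?M e \<in> carrier_mat (D \<nu>) dE" if "e \<in> ?F" for e
      using that Cc[of e] Ac[OF src[of e], of "?U (fst k)"] by (auto simp: edge_map_def)
    have smult: "(c \<cdot>\<^sub>m M *\<^sub>v u) $ p = c * (M *\<^sub>v u) $ p"
      if "M \<in> carrier_mat (D \<nu>) dE" "u \<in> carrier_vec dE" "p < D \<nu>" for c :: complex and M u p
      using that by (simp add: scalar_prod_def sum_distrib_left mult.assoc)
    have Vexp: "(V \<nu> (g x) *\<^sub>v y) $ r = (\<Sum>p<D \<nu>. V \<nu> (g x) $$ (r, p) * y $ p)"
      if "y \<in> carrier_vec (D \<nu>)" for y
      using that r Vc[OF \<nu> x] by (simp add: scalar_prod_def atLeast0LessThan)
    have Msum: "(\<Sum>e\<in>?F. cnj (b e) * (?M e *\<^sub>v ?E (snd k)) $ p) = complex_of_real (sqrt lam) * a \<nu> k $ p"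
      if p: "p < D \<nu>" for p
    proof -
      have "(\<Sum>e\<in>?F. cnj (b e) * (?M e *\<^sub>v ?E (snd k)) $ p)
          = (\<Sum>e\<in>?F. (cnj (b e) \<cdot>\<^sub>m ?M e *\<^sub>v ?E (snd k)) $ p)"
        using Mc p by (intro sum.cong refl smult[symmetric]) auto
      also have "\<dots> = (finsum (module_mat TYPE(complex) (D \<nu>) dE) (\<lambda>e. cnj (b e) \<cdot>\<^sub>m ?M e) ?F *\<^sub>v ?E (snd k)) $ p"
        using finE Mc p by (intro finsum_mat_mult_vec[symmetric]) auto
      also have "\<dots> = (complex_of_real (sqrt lam) \<cdot>\<^sub>m A \<nu> (?U (fst k)) *\<^sub>v ?E (snd k)) $ p"
        using eig[OF \<nu>, of "?U (fst k)"] by simp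
      finally show ?thesis
        using smult[OF Ac[OF \<nu>, of "?U (fst k)"] _ p, of "?E (snd k)"] by (simp add: a_def)
    qed
    have "(\<Sum>(q, i)\<in>{..<dW} \<times> ?J. cnj (edge_operator Ed src tgt D C b (q, i) j) * (l (fst n) $ q * v n i))
        = (\<Sum>e\<in>?F. cnj (b e) * (mat_adjoint (C e) *\<^sub>v
            (l x \<otimes>\<^sub>v vec (D (src e)) (\<lambda>i. v n (src e, i)))) $ r)"
      using edge_operator_adjoint_apply[OF fin\<Omega> finE src Cc l_carrier[OF x] r] by simp
    also have "\<dots> = (\<Sum>e\<in>?F. cnj (b e) * (V \<nu> (g x) *\<^sub>v (?M e *\<^sub>v ?E (snd k))) $ r)"
      using edge_equiv[OF _ x] vvec[OF src x] by (intro sum.cong refl) auto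
    also have "\<dots> = (\<Sum>e\<in>?F. \<Sum>p<D \<nu>. V \<nu> (g x) $$ (r, p) * (cnj (b e) * (?M e *\<^sub>v ?E (snd k)) $ p))"
    proof (intro sum.cong refl)
      fix e assume "e \<in> ?F"
      then have "?M e *\<^sub>v ?E (snd k) \<in> carrier_vec (D \<nu>)" using Mc by (intro mult_mat_vec_carrier) auto
      then show "cnj (b e) * (V \<nu> (g x) *\<^sub>v (?M e *\<^sub>v ?E (snd k))) $ r
          = (\<Sum>p<D \<nu>. V \<nu> (g x) $$ (r, p) * (cnj (b e) * (?M e *\<^sub>v ?E (snd k)) $ p))"
        by (simp add: Vexp sum_distrib_left mult.left_commute del: index_mult_mat_vec)
    qed
    also have "\<dots> = (\<Sum>p<D \<nu>. V \<nu> (g x) $$ (r, p) * (\<Sum>e\<in>?F. cnj (b e) * (?M e *\<^sub>v ?E (snd k)) $ p))"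
      unfolding sum_distrib_left by (rule sum.swap)
    also have "\<dots> = (\<Sum>p<D \<nu>. complex_of_real (sqrt lam) * (V \<nu> (g x) $$ (r, p) * a \<nu> k $ p))"
      using Msum by (intro sum.cong refl) (simp only: lessThan_iff mult.left_commute)
    also have "\<dots> = complex_of_real (sqrt lam) * v n j"
      unfolding sum_distrib_left[symmetric] using Vexp[OF ac[OF \<nu>, of k]] by (simp add: v_def del: index_mult_mat_vec)
    finally show ?thesis .
  qed

  \<comment> \<open>Block traces and profile weights\<close>
  have weight: "(\<Sum>r<D \<omega>. (cmod (v (x, k) (\<omega>, r)))\<^sup>2)
      = Re (hom_inner dE (A \<omega> (?U (fst k))) (A \<omega> (?U (fst k))))"
    if "\<omega> \<in> \<Omega>" "x \<in> X" "k \<in> ?K" for \<omega> x k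
  proof -
    have "complex_of_real (\<Sum>r<D \<omega>. (cmod (v (x, k) (\<omega>, r)))\<^sup>2)
        = hom_inner dE (A \<omega> (?U (fst k))) (A \<omega> (?U (fst k)))"
      using block[OF that that(3)] by (simp only: of_real_sum complex_norm_square) simp
    then show ?thesis by (metis Re_complex_of_real)
  qed
  have q: "profile_weight dE m A \<omega> = (\<Sum>i<m. Re (hom_inner dE (A \<omega> (?U i)) (A \<omega> (?U i))))"
    if "\<omega> \<in> \<Omega>" for \<omega>
  proof -
    \<comment> \<open>The profile weight is the square of a square root, so the radicand must be
      nonnegative. Each term is a squared norm, seen by taking \<open>weight\<close> at
      \<open>x0\<close> with index 0 in \<open>E\<close>, which exists because \<open>dE\<close> is
      positive.\<close>
    have "0 \<le> Re (hom_inner dE (A \<omega> (?U i)) (A \<omega> (?U i)))" if "i < m" for i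
      using weight[OF \<open>\<omega> \<in> \<Omega>\<close> x0, of "(i, 0)"] that dE
        sum_nonneg[of "{..<D \<omega>}" "\<lambda>r. (cmod (v (x0, (i, 0)) (\<omega>, r)))\<^sup>2"] by simp
    then have "0 \<le> (\<Sum>i<m. Re (hom_inner dE (A \<omega> (?U i)) (A \<omega> (?U i))))"
      by (intro sum_nonneg) simp
    then show ?thesis
      by (simp add: profile_weight_def frobenius_norm_def)
  qed
  \<comment> \<open>Proved for an arbitrary code \<open>Y\<close> and before any cancellation,
    because it is used twice: for \<open>code\<close>, and for \<open>{x0}\<close> to bound
    \<open>s\<close>.\<close>
  have core: "(lam - s) * ((real (card Y))\<^sup>2 * (real dE)\<^sup>2 * profile_Delta dE m \<Omega> D A)
      \<le> (1 - s) * (real (card Y) * (real m * real dE))"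
    if Y: "Y \<subseteq> X" and le: "\<And>x y. x \<in> Y \<Longrightarrow> y \<in> Y \<Longrightarrow> x \<noteq> y \<Longrightarrow> t x y \<le> s" for Y
  proof -
    have finY: "finite Y" using Y finX by (rule finite_subset)
    have "(sqrt lam)\<^sup>2 * gram_energy ?J (Y \<times> ?K) v
        \<le> (\<Sum>n\<in>Y \<times> ?K. \<Sum>n'\<in>Y \<times> ?K. Re (ip {..<dW} (\<lambda>q. l (fst n) $ q) (\<lambda>q. l (fst n') $ q))
            * (cmod (ip ?J (v n) (v n')))\<^sup>2)"
      by (rule gram_contraction[OF contr]) (use eigv Y in blast)+
    also have "\<dots> = (\<Sum>n\<in>Y \<times> ?K. \<Sum>n'\<in>Y \<times> ?K. t (fst n) (fst n') * (cmod (ip ?J (v n) (v n')))\<^sup>2)"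
    proof (intro sum.cong refl)
      fix n n' assume "n \<in> Y \<times> ?K" "n' \<in> Y \<times> ?K"
      then have "fst n \<in> X" "fst n' \<in> X" using Y by auto
      then have "ip {..<dW} (\<lambda>q. l (fst n) $ q) (\<lambda>q. l (fst n') $ q) = complex_of_real (t (fst n) (fst n'))"
        using lt l_carrier by (subst cscalar_prod_eq_ip[symmetric]) auto
      then show "Re (ip {..<dW} (\<lambda>q. l (fst n) $ q) (\<lambda>q. l (fst n') $ q)) * (cmod (ip ?J (v n) (v n')))\<^sup>2
          = t (fst n) (fst n') * (cmod (ip ?J (v n) (v n')))\<^sup>2" by simp
    qed
    finally have lower: "lam * gram_energy ?J (Y \<times> ?K) v
        \<le> (\<Sum>n\<in>Y \<times> ?K. \<Sum>n'\<in>Y \<times> ?K. t (fst n) (fst n') * (cmod (ip ?J (v n) (v n')))\<^sup>2)"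
      using lam0 by simp
    have one: "t x x = 1" if "x \<in> Y" for x
      using that Y lt[of x x] l_norm[of x] by (metis of_real_eq_1_iff subsetD)
    have upper: "(lam - s) * gram_energy ?J (Y \<times> ?K) v \<le> (1 - s) * (real (card Y) * real (card ?K))"
      by (rule gram_energy_upper_bound[OF finY _ orth[OF subsetD[OF Y]] le one lower]) simp
    \<comment> \<open>The value in \<open>weight\<close> depends neither on the point nor on the
      index in \<open>E\<close>; these two account for the factors \<open>card Y\<close> and
      \<open>dE\<close>.\<close>
    have "(\<Sum>n\<in>Y \<times> ?K. \<Sum>r<D \<omega>. (cmod (v n (\<omega>, r)))\<^sup>2) = real (card Y) * real dE * profile_weight dE m A \<omega>"
      if "\<omega> \<in> \<Omega>" for \<omega>
    proof -
      have "(\<Sum>n\<in>Y \<times> ?K. \<Sum>r<D \<omega>. (cmod (v n (\<omega>, r)))\<^sup>2)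
          = (\<Sum>n\<in>Y \<times> ?K. Re (hom_inner dE (A \<omega> (?U (fst (snd n)))) (A \<omega> (?U (fst (snd n))))))"
        using weight[OF that] Y by (intro sum.cong refl) auto
      also have "\<dots> = (\<Sum>x\<in>Y. \<Sum>i<m. \<Sum>j<dE. Re (hom_inner dE (A \<omega> (?U i)) (A \<omega> (?U i))))"
        by (simp only: sum.cartesian_product) (simp add: case_prod_unfold)
      also have "\<dots> = real (card Y) * real dE * (\<Sum>i<m. Re (hom_inner dE (A \<omega> (?U i)) (A \<omega> (?U i))))"
        by (simp add: sum_distrib_left mult.assoc)
      finally show ?thesis by (simp only: q[OF that])
    qed
    then have "(\<Sum>\<omega>\<in>\<Omega>. (real (card Y) * real dE * profile_weight dE m A \<omega>)\<^sup>2 / real (D \<omega>))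
        \<le> gram_energy ?J (Y \<times> ?K) v"
      using gram_energy_block_lower_bound[OF fin\<Omega>, where B = "\<lambda>\<omega>. {..<D \<omega>}" and N = "Y \<times> ?K" and v = v]
      by simp
    then have "(real (card Y))\<^sup>2 * (real dE)\<^sup>2 * profile_Delta dE m \<Omega> D A \<le> gram_energy ?J (Y \<times> ?K) v"
      by (simp add: profile_Delta_def sum_distrib_left power_mult_distrib)
    then have "(lam - s) * ((real (card Y))\<^sup>2 * (real dE)\<^sup>2 * profile_Delta dE m \<Omega> D A)
        \<le> (lam - s) * gram_energy ?J (Y \<times> ?K) v"
      using lam by (intro mult_left_mono) auto
    then show ?thesis using upper by (simp add: card_cartesian_product)
  qed

  \<comment> \<open>Positivity of the denominator and the final division\<close>
  have \<Delta>: "0 < profile_Delta dE m \<Omega> D A"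
  proof -
    have "complex_of_real (real m) = (\<Sum>i<m. ?U i \<bullet>c ?U i)"
      using unit_vec_inner[of _ m] by simp
    also have "\<dots> = (\<Sum>i<m. \<Sum>\<omega>\<in>\<Omega>. hom_inner dE (A \<omega> (?U i)) (A \<omega> (?U i)))"
      by (intro sum.cong refl sum_hom_inner_partition[OF irr\<tau> un\<tau> unH fin\<Omega> A part, symmetric]) auto
    also have "\<dots> = (\<Sum>\<omega>\<in>\<Omega>. \<Sum>i<m. hom_inner dE (A \<omega> (?U i)) (A \<omega> (?U i)))"
      by (rule sum.swap)
    \<comment> \<open>The trace of the resolution of the identity: the weights sum to the positive
      number \<open>m\<close>, so one of them is nonzero and its summand in
      \<open>profile_Delta\<close> is positive.\<close>
    finally have "real m = (\<Sum>\<omega>\<in>\<Omega>. profile_weight dE m A \<omega>)"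
      by (metis (no_types, lifting) Re_complex_of_real Re_sum q sum.cong)
    then have "(\<Sum>\<omega>\<in>\<Omega>. profile_weight dE m A \<omega>) \<noteq> 0" using m by simp
    then obtain \<omega> where \<omega>: "\<omega> \<in> \<Omega>" "profile_weight dE m A \<omega> \<noteq> 0"
      using sum.neutral by metis
    have "0 < D \<omega>" using irrV[OF \<omega>(1)] by (simp add: irreducible_rep_def)
    then show ?thesis
      unfolding profile_Delta_def using \<omega> fin\<Omega> by (intro sum_pos2[of \<Omega> \<omega>]) auto
  qed
  let ?B = "real dE * (lam - s) * profile_Delta dE m \<Omega> D A"
  have B: "0 < ?B" using dE lam \<Delta> by simp
  have "0 \<le> (lam - s) * ((real dE)\<^sup>2 * profile_Delta dE m \<Omega> D A)"
    using lam \<Delta> by simp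
  \<comment> \<open>the one-point code gives \<open>s \<le> 1\<close>, needed when \<open>code\<close> is empty\<close>
  also have "\<dots> \<le> (1 - s) * (real m * real dE)"
    using core[of "{x0}"] x0 by simp
  finally have nonneg: "0 \<le> (1 - s) * (real m * real dE)" .
  have s1: "0 \<le> 1 - s"
  proof (rule ccontr)
    assume "\<not> 0 \<le> 1 - s"
    then have "(1 - s) * (real m * real dE) < 0"
      using m dE by (intro mult_neg_pos mult_pos_pos) auto
    then show False using nonneg by simp
  qed
  show ?thesis
  proof (cases "card code = 0")
    case True
    then show ?thesis using B s1 by simp
  next
    case False
    then have pos: "0 < real (card code) * real dE" using dE by simp
    \<comment> \<open>Both sides of \<open>core\<close> share the factor \<open>card code\<close>
      times \<open>dE\<close>, which is positive here and cancels.\<close>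
    have "real (card code) * real dE * (real (card code) * ?B) \<le> real (card code) * real dE * ((1 - s) * real m)"
      using core[OF code_sub code_le] by (simp add: power2_eq_square ac_simps)
    then have "real (card code) * ?B \<le> (1 - s) * real m"
      using pos by (rule mult_le_cancel_left_pos[THEN iffD1, rotated])
    then show ?thesis using B by (simp add: pos_le_divide_eq)
  qed
qed

end
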